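(* Let $\mu$ be a probability measure on $\mathbb{R}$ whose support is a finite set. Then there exist $n\ge1$ and a self-adjoint $M_n(\mathbb{C})$-valued semicircular random variable $s$ whose variance $\eta:M_n(\mathbb{C})\to M_n(\mathbb{C})$ is nilpotent, such that $\mu$ is a component of the distribution $\mu_s$ of $s$.
   Context: Component: for probability measures $\mu,\nu$ on $\mathbb{R}$, $\nu$ is a component of $\mu$ if there is a finite family $\{\nu_1,\dots,\nu_N\}$ of probability measures on $\mathbb{R}$ with $\nu\in\{\nu_1,\dots,\nu_N\}$ and $\mu=\sum_{j=1}^N\alpha_j\nu_j$ for some $\alpha_1,\dots,\alpha_N\in(0,1]$ with $\alpha_1+\cdots+\alpha_N=1$. A linear map $\eta$ is nilpotent if its $m$-fold composition $\eta^m$ is $0$ for some $m\ge1$. Operator-valued semicircular random variables: let $A$ be a unital $C^*$-algebra, $\mathcal{B}\subseteq A$ a unital $C^*$-subalgebra (here $\mathcal{B}=M_n(\mathbb{C})$), and $E:A\to\mathcal{B}$ a conditional expectation, i.e. a linear map with $E(b_1ab_2)=b_1E(a)b_2$ for $a\in A$, $b_1,b_2\in\mathcal{B}$, $E(1)=1$, and $E(a^*a)\ge0$. Put $\mathbb{H}^{\pm}(\mathcal{B})=\{b\in\mathcal{B}:\pm\mathrm{Im}(b)\geq\epsilon\cdot1\text{ for some }\epsilon>0\}$, where $\mathrm{Im}(b)=(b-b^* )/(2i)$. The operator-valued Cauchy transform of a self-adjoint $a\in A$ is $G_a:\mathbb{H}^+(\mathcal{B})\to\mathbb{H}^-(\mathcal{B})$,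 $G_a(b)=E((b-a)^{-1})$. For a self-adjoint $D\in\mathcal{B}$ and a completely positive map $\eta:\mathcal{B}\to\mathcal{B}$, a self-adjoint $s\in A$ is called a $\mathcal{B}$-valued semicircular random variable with first moment $D$ and variance $\eta$ if its operator-valued $R$-transform, determined by $bG_s(b)=1+R_s(G_s(b))G_s(b)$, is $R_s(b)=D+\eta(b)$. Then $D=E(s)$ and $\eta(b)=E(sbs)-E(s)bE(s)$, and equivalently $G_s$ is the unique solution $\mathbb{H}^+(\mathcal{B})\to\mathbb{H}^-(\mathcal{B})$ of $bG_s(b)=1+(D+\eta(G_s(b)))G_s(b)$ for $b\in\mathbb{H}^+(\mathcal{B})$, with $\lim_{b^{-1}\to0}bG_s(b)=1$. The first moment $D$ is not required to be $0$; the ambient $A$ and $E$ are part of what is asserted to exist. Distribution: with $\mathrm{tr}_n$ the normalized trace on $M_n(\mathbb{C})$, the distribution $\mu_s$ is the unique probability measure on $\mathbb{R}$ with $\mathrm{tr}_n(G_s(\xi\cdot1))=\int_{\mathbb{R}}\frac{d\mu_s(t)}{\xi-t}$ for all $\xi\in\mathbb{C}$ with $\mathrm{Im}\,\xi>0$. *)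

theory Defs
  imports
    "HOL-Probability.Probability"
    "Jordan_Normal_Form.Schur_Decomposition"
    "Jordan_Normal_Form.VS_Connect"
begin

section \<open>Probability measures on the real line\<close>

text \<open>The topological support: the points all of whose open neighbourhoods have positive mass.\<close>

definition measure_support :: "real measure \<Rightarrow> real set" where
  "measure_support M = {x. \<forall>U. open U \<longrightarrow> x \<in> U \<longrightarrow> measure M U > 0}"

definition is_component :: "real measure \<Rightarrow> real measure \<Rightarrow> bool" where
  "is_component \<nu> \<mu> \<longleftrightarrow> (\<exists>(N::nat) (\<nu>s :: nat \<Rightarrow> real measure) (\<alpha> :: nat \<Rightarrow> real).
     (\<forall>j<N. real_distribution (\<nu>s j)) \<and>
     (\<exists>j<N. \<nu>s j = \<nu>) \<and>
     (\<forall>j<N. 0 < \<alpha> j \<and> \<alpha> j \<le> 1) \<and>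
     (\<Sum>j<N. \<alpha> j) = 1 \<and>
     (\<forall>X\<in>sets borel. measure \<mu> X = (\<Sum>j<N. \<alpha> j * measure (\<nu>s j) X)))"


section \<open>Unital C*-algebras\<close>

record 'a cstar = "(complex, 'a) module" +
  star :: "'a \<Rightarrow> 'a"
  cnorm :: "'a \<Rightarrow> real"

text \<open>
  Existence of a C*-algebra \<open>A\<close> can only be stated over a fixed element type. Any type with at least
  continuum many elements (such as \<open>complex mat\<close>) accommodates, up to isomorphism, every separable
  C*-algebra, in particular the one generated by a matrix subalgebra and a single element; the
  operations of \<open>A\<close> need not be related to the operations of the element type.

  The scalars are \<open>class_ring\<close>, the field of complex numbers as a HOL-Algebra ring. The library
  locale \<open>algebra\<close> demands commutativity of the multiplication, hence \<open>ring\<close> and \<open>module\<close>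
  together with the two compatibility laws between scalars and multiplication.
\<close>

locale cstar_algebra =
  fixes A :: "'a cstar" (structure)
  assumes ring: "Ring.ring A"
    and module: "Module.module (class_ring :: complex ring) A"
    and smult_mult_left: "\<lbrakk>x \<in> carrier A; y \<in> carrier A\<rbrakk> \<Longrightarrow> (c \<odot> x) \<otimes> y = c \<odot> (x \<otimes> y)"
    and smult_mult_right: "\<lbrakk>x \<in> carrier A; y \<in> carrier A\<rbrakk> \<Longrightarrow> x \<otimes> (c \<odot> y) = c \<odot> (x \<otimes> y)"
    and star_closed: "x \<in> carrier A \<Longrightarrow> star A x \<in> carrier A"
    and star_star: "x \<in> carrier A \<Longrightarrow> star A (star A x) = x"
    and star_add: "\<lbrakk>x \<in> carrier A; y \<in> carrier A\<rbrakk> \<Longrightarrow> star A (x \<oplus> y) = star A x \<oplus> star A y"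
    and star_smult: "x \<in> carrier A \<Longrightarrow> star A (c \<odot> x) = cnj c \<odot> star A x"
    and star_mult: "\<lbrakk>x \<in> carrier A; y \<in> carrier A\<rbrakk> \<Longrightarrow> star A (x \<otimes> y) = star A y \<otimes> star A x"
    and norm_nonneg: "x \<in> carrier A \<Longrightarrow> 0 \<le> cnorm A x"
    and norm_eq_zero: "x \<in> carrier A \<Longrightarrow> cnorm A x = 0 \<longleftrightarrow> x = \<zero>"
    and norm_smult: "x \<in> carrier A \<Longrightarrow> cnorm A (c \<odot> x) = cmod c * cnorm A x"
    and norm_triangle: "\<lbrakk>x \<in> carrier A; y \<in> carrier A\<rbrakk> \<Longrightarrow> cnorm A (x \<oplus> y) \<le> cnorm A x + cnorm A y"
    and norm_mult: "\<lbrakk>x \<in> carrier A; y \<in> carrier A\<rbrakk> \<Longrightarrow> cnorm A (x \<otimes> y) \<le> cnorm A x * cnorm A y"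
    and cstar_identity: "x \<in> carrier A \<Longrightarrow> cnorm A (star A x \<otimes> x) = (cnorm A x)\<^sup>2"
    and complete:
      "\<lbrakk>range X \<subseteq> carrier A; \<forall>e>0. \<exists>N. \<forall>i\<ge>N. \<forall>j\<ge>N. cnorm A (X i \<ominus> X j) < e\<rbrakk>
        \<Longrightarrow> \<exists>x\<in>carrier A. (\<lambda>i::nat. cnorm A (X i \<ominus> x)) \<longlonglongrightarrow> 0"


section \<open>The algebra of complex matrices\<close>

definition psd_mat :: "nat \<Rightarrow> complex mat \<Rightarrow> bool" where
  "psd_mat n P \<longleftrightarrow> P \<in> carrier_mat n n \<and> mat_adjoint P = P \<and>
     (\<forall>v\<in>carrier_vec n. 0 \<le> Re ((P *\<^sub>v v) \<bullet>c v))"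

definition im_mat :: "complex mat \<Rightarrow> complex mat" where
  "im_mat b = (1 / (2 * \<i>)) \<cdot>\<^sub>m (b - mat_adjoint b)"

definition upper_half :: "nat \<Rightarrow> complex mat set" where
  "upper_half n = {b \<in> carrier_mat n n.
     \<exists>\<epsilon>::real. \<epsilon> > 0 \<and> psd_mat n (im_mat b - complex_of_real \<epsilon> \<cdot>\<^sub>m 1\<^sub>m n)}"

definition norm_trace :: "nat \<Rightarrow> complex mat \<Rightarrow> complex" where
  "norm_trace n b = (\<Sum>i<n. b $$ (i, i)) / of_nat n"

definition linear_mat_map :: "nat \<Rightarrow> (complex mat \<Rightarrow> complex mat) \<Rightarrow> bool" where
  "linear_mat_map n \<eta> \<longleftrightarrow>
     (\<forall>b\<in>carrier_mat n n. \<eta> b \<in> carrier_mat n n) \<and>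
     (\<forall>b\<in>carrier_mat n n. \<forall>c\<in>carrier_mat n n. \<eta> (b + c) = \<eta> b + \<eta> c) \<and>
     (\<forall>z. \<forall>b\<in>carrier_mat n n. \<eta> (z \<cdot>\<^sub>m b) = z \<cdot>\<^sub>m \<eta> b)"

text \<open>
  A \<open>k * n\<close> by \<open>k * n\<close> matrix is read as a \<open>k\<close> by \<open>k\<close> matrix of blocks of size \<open>n\<close>, that is, as an
  element of $M_k(M_n(\mathbb{C}))$; \<open>amplify\<close> applies \<open>\<eta>\<close> to every block.
\<close>

definition mat_block :: "nat \<Rightarrow> complex mat \<Rightarrow> nat \<Rightarrow> nat \<Rightarrow> complex mat" where
  "mat_block n P p q = Matrix.mat n n (\<lambda>(i, j). P $$ (p * n + i, q * n + j))"

definition amplify ::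
  "nat \<Rightarrow> nat \<Rightarrow> (complex mat \<Rightarrow> complex mat) \<Rightarrow> complex mat \<Rightarrow> complex mat" where
  "amplify k n \<eta> P = Matrix.mat (k * n) (k * n)
     (\<lambda>(i, j). \<eta> (mat_block n P (i div n) (j div n)) $$ (i mod n, j mod n))"

definition completely_positive :: "nat \<Rightarrow> (complex mat \<Rightarrow> complex mat) \<Rightarrow> bool" where
  "completely_positive n \<eta> \<longleftrightarrow> linear_mat_map n \<eta> \<and>
     (\<forall>k\<ge>1. \<forall>P. psd_mat (k * n) P \<longrightarrow> psd_mat (k * n) (amplify k n \<eta> P))"

definition nilpotent_mat_map :: "nat \<Rightarrow> (complex mat \<Rightarrow> complex mat) \<Rightarrow> bool" where
  "nilpotent_mat_map n \<eta> \<longleftrightarrow> (\<exists>m\<ge>1. \<forall>b\<in>carrier_mat n n. (\<eta> ^^ m) b = 0\<^sub>m n n)"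


section \<open>Matrix-valued probability spaces\<close>

text \<open>
  The unital C*-subalgebra $M_n(\mathbb{C})$ of \<open>A\<close> is given by its inclusion \<open>\<iota>\<close>, a unital injective
  *-homomorphism (automatically isometric, with closed range).
\<close>

locale mat_prob_space = cstar_algebra A for A :: "'a cstar" (structure) +
  fixes n :: nat and \<iota> :: "complex mat \<Rightarrow> 'a" and E :: "'a \<Rightarrow> complex mat"
  assumes n_pos: "n \<ge> 1"
    and incl_hom: "\<iota> \<in> Ring.ring_hom (ring_mat TYPE(complex) n ()) A"
    and incl_smult: "b \<in> carrier_mat n n \<Longrightarrow> \<iota> (c \<cdot>\<^sub>m b) = c \<odot> \<iota> b"
    and incl_star: "b \<in> carrier_mat n n \<Longrightarrow> \<iota> (mat_adjoint b) = star A (\<iota> b)"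
    and incl_inj: "inj_on \<iota> (carrier_mat n n)"
    and E_closed: "a \<in> carrier A \<Longrightarrow> E a \<in> carrier_mat n n"
    and E_add: "\<lbrakk>x \<in> carrier A; y \<in> carrier A\<rbrakk> \<Longrightarrow> E (x \<oplus> y) = E x + E y"
    and E_smult: "x \<in> carrier A \<Longrightarrow> E (c \<odot> x) = c \<cdot>\<^sub>m E x"
    and E_bimodule: "\<lbrakk>a \<in> carrier A; b \<in> carrier_mat n n; b' \<in> carrier_mat n n\<rbrakk>
          \<Longrightarrow> E (\<iota> b \<otimes> a \<otimes> \<iota> b') = b * E a * b'"
    and E_one: "E \<one> = 1\<^sub>m n"
    and E_pos: "a \<in> carrier A \<Longrightarrow> psd_mat n (E (star A a \<otimes> a))"

definition op_cauchy ::
  "'a cstar \<Rightarrow> (complex mat \<Rightarrow> 'a) \<Rightarrow> ('a \<Rightarrow> complex mat) \<Rightarrow> 'a \<Rightarrow> complex mat \<Rightarrow> complex mat" where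
  "op_cauchy A \<iota> E a b = E (inv\<^bsub>A\<^esub> (\<iota> b \<ominus>\<^bsub>A\<^esub> a))"

text \<open>
  The functional equation determines an \<open>R\<close> that is analytic near 0. It is imposed on the whole
  (connected) half-plane: for the affine \<open>R\<close> used below this is the same, by analytic
  continuation, as imposing it only for \<open>b\<close> with small inverse.
\<close>

definition has_R_transform ::
  "nat \<Rightarrow> (complex mat \<Rightarrow> complex mat) \<Rightarrow> (complex mat \<Rightarrow> complex mat) \<Rightarrow> bool" where
  "has_R_transform n G R \<longleftrightarrow> (\<forall>b\<in>upper_half n. b * G b = 1\<^sub>m n + R (G b) * G b)"

definition is_semicircular ::
  "nat \<Rightarrow> 'a cstar \<Rightarrow> (complex mat \<Rightarrow> 'a) \<Rightarrow> ('a \<Rightarrow> complex mat) \<Rightarrow>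
   complex mat \<Rightarrow> (complex mat \<Rightarrow> complex mat) \<Rightarrow> 'a \<Rightarrow> bool" where
  "is_semicircular n A \<iota> E D \<eta> s \<longleftrightarrow>
     s \<in> carrier A \<and> star A s = s \<and>
     D \<in> carrier_mat n n \<and> mat_adjoint D = D \<and>
     completely_positive n \<eta> \<and>
     has_R_transform n (op_cauchy A \<iota> E s) (\<lambda>b. D + \<eta> b)"

text \<open>At most one \<open>\<mu>\<close> satisfies this, by Stieltjes inversion.\<close>

definition has_distribution ::
  "nat \<Rightarrow> 'a cstar \<Rightarrow> (complex mat \<Rightarrow> 'a) \<Rightarrow> ('a \<Rightarrow> complex mat) \<Rightarrow> 'a \<Rightarrow> real measure \<Rightarrow> bool" where
  "has_distribution n A \<iota> E a \<mu> \<longleftrightarrow> real_distribution \<mu> \<and>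
     (\<forall>\<xi>::complex. Im \<xi> > 0 \<longrightarrow>
        norm_trace n (op_cauchy A \<iota> E a (\<xi> \<cdot>\<^sub>m 1\<^sub>m n))
          = (LINT t|\<mu>. 1 / (\<xi> - complex_of_real t)))"

end

(* Let l be the unilateral shift on l^2(N). For D self-adjoint and V in M_n(C), the operator
   s = D + V l^* + V^* l on C^n (x) l^2(N) is semicircular with first moment D and variance
   b |-> V b V^* with respect to the vacuum expectation: compressing the resolvent of s by the
   coshift gives the functional equation. The vacuum state is not tracial on the algebra generated
   by l, which is what allows this variance to be nilpotent, namely as soon as V^2 = 0.

   For D = diag(a, d_1, ..., d_r) and V with the only nonzero row (0, v_1, ..., v_r), the diagonal
   entries of G_s(z 1) are 1 / (z - a - sum_j v_j^2 / (z - d_j)) and 1 / (z - d_j). The Cauchy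
   transform of a finitely supported probability measure mu has the first form, d_1, ..., d_r being
   its zeros, which are real and simple; the distribution of s is then the average of mu and of the
   point masses at the d_j. *)

theory Submission
  imports Defs "HOL-Computational_Algebra.Fundamental_Theorem_Algebra"
begin

section \<open>The Hilbert space of square-summable sequences\<close>

text \<open>No uniqueness for the functional equation is invoked. At b = z 1 the term V G V^* sits
  in the corner entry, so the equations in the rows j > 0 are linear and fix those rows of G; the
  corner entry then solves an equation whose other terms are known. The resolvent exists because s
  is self-adjoint while Im b is bounded below, so b - s is dissipative. The numbers come from 1 /
  G_mu. Off the real line Im G_mu has the sign opposite to Im z, so the zeros are real; on the line
  G_mu' = -H < 0, so they are simple and 1 / G_mu has residue -1 / H(d_j) there. Hence v_j^2 = 1 /
  H(d_j) is positive, and a is the remaining constant, the mean of mu. Two encodings shape the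
  operator side. The type \<open>operator\<close> consists of real-linear maps; demanding an adjoint
  for the complex inner product cuts out complex-linear ones. The space C^n \<otimes> l^2(N) is
  \<open>ell2\<close> itself with coordinates grouped in blocks of n, so that one type serves every
  n, and its operators are coded as elements of \<open>complex mat\<close>, the element type fixed
  in the theorem.\<close>

typedef ell2 = "{f :: nat \<Rightarrow> complex. (\<lambda>m. (cmod (f m))\<^sup>2) summable_on UNIV}"
  morphisms coord ell2_of
  by (rule exI[of _ "\<lambda>_. 0"]) simp

lemma square_summable_coord: "(\<lambda>m. (cmod (coord x m))\<^sup>2) summable_on UNIV"
  using coord[of x] by simp

lemma coord_ell2_of: "(\<lambda>m. (cmod (f m))\<^sup>2) summable_on UNIV \<Longrightarrow> coord (ell2_of f) = f"
  by (simp add: ell2_of_inverse)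

lemma ell2_eqI: "(\<And>m. coord x m = coord y m) \<Longrightarrow> x = y"
  by (metis coord_inverse ext)

lemma square_summable_add:
  assumes "(\<lambda>m. (cmod (f m))\<^sup>2) summable_on A" "(\<lambda>m. (cmod (g m))\<^sup>2) summable_on A"
  shows "(\<lambda>m. (cmod (f m + g m))\<^sup>2) summable_on A"
proof (rule summable_on_comparison_test)
  show "(\<lambda>m. 2 * (cmod (f m))\<^sup>2 + 2 * (cmod (g m))\<^sup>2) summable_on A"
    by (intro summable_on_add summable_on_cmult_right assms)
  fix m
  have "(cmod (f m + g m))\<^sup>2 \<le> (cmod (f m) + cmod (g m))\<^sup>2"
    by (intro power_mono norm_triangle_ineq) simp
  also have "\<dots> \<le> 2 * (cmod (f m))\<^sup>2 + 2 * (cmod (g m))\<^sup>2"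
    using sum_squares_bound[of "cmod (f m)" "cmod (g m)"] by (simp add: power2_sum)
  finally show "(cmod (f m + g m))\<^sup>2 \<le> 2 * (cmod (f m))\<^sup>2 + 2 * (cmod (g m))\<^sup>2" .
qed simp

lemma square_summable_cmult:
  assumes "(\<lambda>m. (cmod (f m))\<^sup>2) summable_on A"
  shows "(\<lambda>m. (cmod (c * f m))\<^sup>2) summable_on A"
  unfolding norm_mult power_mult_distrib by (intro summable_on_cmult_right assms)

text \<open>\<open>real_vector\<close> provides the real scalars; the complex ones enter through
  this operation, and complex linearity of a map is tracked as commutation with it.\<close>

definition cscale :: "complex \<Rightarrow> ell2 \<Rightarrow> ell2" where
  "cscale c x = ell2_of (\<lambda>m. c * coord x m)"

instantiation ell2 :: real_vector
begin
definition "0 = ell2_of (\<lambda>_. 0)"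
definition "x + y = ell2_of (\<lambda>m. coord x m + coord y m)"
definition "- x = cscale (-1) x"
definition "x - y = x + (- y :: ell2)"
definition "r *\<^sub>R x = cscale (complex_of_real r) x"

lemma coord_cscale [simp]: "coord (cscale c x) m = c * coord x m"
  unfolding cscale_def by (subst coord_ell2_of[OF square_summable_cmult[OF square_summable_coord]]) simp

lemma coord_zero [simp]: "coord 0 m = 0"
  unfolding zero_ell2_def by (subst coord_ell2_of) auto

lemma coord_add [simp]: "coord (x + y) m = coord x m + coord y m"
  unfolding plus_ell2_def
  by (subst coord_ell2_of[OF square_summable_add[OF square_summable_coord square_summable_coord]]) simp

lemma coord_uminus [simp]: "coord (- x) m = - coord x m"
  by (simp add: uminus_ell2_def)

lemma coord_diff [simp]: "coord (x - y) m = coord x m - coord y m"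
  by (simp add: minus_ell2_def)

lemma coord_scaleR [simp]: "coord (r *\<^sub>R x) m = r *\<^sub>R coord x m"
  by (simp add: scaleR_ell2_def scaleR_conv_of_real)

instance
  by standard (auto intro!: ell2_eqI simp: algebra_simps)
end

instantiation ell2 :: real_inner
begin
text \<open>The real part of the Hermitian product, as the class \<open>real_inner\<close> demands;
  \<open>cinner\<close> recovers the imaginary part.\<close>

definition "inner x y = infsum (\<lambda>m. inner (coord x m) (coord y m)) UNIV"
definition "norm (x :: ell2) = sqrt (inner x x)"
definition "dist (x :: ell2) y = norm (x - y)"
definition "sgn (x :: ell2) = x /\<^sub>R norm x"
definition
  "(uniformity :: (ell2 \<times> ell2) filter) = (INF e\<in>{0<..}. principal {(x, y). dist x y < e})"
definition
  "open (U :: ell2 set) \<longleftrightarrow> (\<forall>x\<in>U. \<forall>\<^sub>F (x', y) in uniformity. x' = x \<longrightarrow> y \<in> U)"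

lemma summable_on_inner_coord:
  "(\<lambda>m. inner (coord x m) (coord y m)) summable_on UNIV"
proof -
  have "norm (inner (coord x m) (coord y m)) \<le> (cmod (coord x m))\<^sup>2 + (cmod (coord y m))\<^sup>2" for m
  proof -
    have "norm (inner (coord x m) (coord y m)) \<le> cmod (coord x m) * cmod (coord y m)"
      using Cauchy_Schwarz_ineq2 by simp
    then show ?thesis
      using sum_squares_bound[of "cmod (coord x m)" "cmod (coord y m)"]
        mult_nonneg_nonneg[OF norm_ge_zero norm_ge_zero, of "coord x m" "coord y m"] by linarith
  qed
  then have "(\<lambda>m. norm (inner (coord x m) (coord y m))) summable_on UNIV"
    by (intro Infinite_Sum.abs_summable_on_comparison_test'[OF summable_on_add[OF square_summable_coord square_summable_coord]])
  then show ?thesis by (rule iffD2[OF summable_on_iff_abs_summable_on_real])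
qed

instance
proof
  fix x y z :: ell2 and r :: real
  show "inner x y = inner y x"
    by (simp add: inner_ell2_def inner_commute)
  show "inner (x + y) z = inner x z + inner y z"
    by (simp add: inner_ell2_def inner_add_left infsum_add summable_on_inner_coord)
  show "inner (r *\<^sub>R x) y = r * inner x y"
    by (simp add: inner_ell2_def infsum_cmult_right')
  show "0 \<le> inner x x"
    by (simp add: inner_ell2_def infsum_nonneg)
  show "inner x x = 0 \<longleftrightarrow> x = 0"
  proof
    assume *: "inner x x = 0"
    have "inner (coord x m) (coord x m) = 0" for m
      by (rule nonneg_infsum_le_0D[where A = UNIV])
         (use * in \<open>auto simp: inner_ell2_def summable_on_inner_coord\<close>)
    then show "x = 0" by (intro ell2_eqI) simp
  qed (simp add: inner_ell2_def)
qed (simp_all add: dist_ell2_def norm_ell2_def sgn_ell2_def uniformity_ell2_def open_ell2_def)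
end

section \<open>Norm and completeness\<close>

lemma norm_ell2_sq: "(norm x)\<^sup>2 = infsum (\<lambda>m. (cmod (coord x m))\<^sup>2) UNIV" for x :: ell2
  by (simp add: power2_norm_eq_inner inner_ell2_def)

lemma norm_coord_le: "cmod (coord x m) \<le> norm x"
proof -
  have "sum (\<lambda>m. (cmod (coord x m))\<^sup>2) {m} \<le> infsum (\<lambda>m. (cmod (coord x m))\<^sup>2) UNIV"
    by (rule finite_sum_le_infsum[OF square_summable_coord]) auto
  then show ?thesis by (simp add: norm_ell2_sq[symmetric])
qed

instance ell2 :: complete_space
proof
  fix X :: "nat \<Rightarrow> ell2"
  assume X: "Cauchy X"
  have "Cauchy (\<lambda>i. coord (X i) m)" for m
  proof (rule metric_CauchyI)
    fix e :: real assume "e > 0"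
    then obtain M where "\<forall>i\<ge>M. \<forall>j\<ge>M. dist (X i) (X j) < e"
      using metric_CauchyD[OF X] by blast
    then show "\<exists>M. \<forall>i\<ge>M. \<forall>j\<ge>M. dist (coord (X i) m) (coord (X j) m) < e"
      by (metis coord_diff dist_norm norm_coord_le order_le_less_trans)
  qed
  then have "\<exists>l. (\<lambda>i. coord (X i) m) \<longlonglongrightarrow> l" for m
    using Cauchy_convergent convergent_def by blast
  then obtain L where L: "(\<lambda>i. coord (X i) m) \<longlonglongrightarrow> L m" for m by metis
  \<comment> \<open>As in Fatou's lemma: on a finite set \<open>F\<close> the limit in
    \<open>j\<close> is taken termwise, and the resulting bound does not depend on
    \<open>F\<close>.\<close>
  have bound: "sum (\<lambda>m. (cmod (coord (X i) m - L m))\<^sup>2) F \<le> e\<^sup>2"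
    if "\<forall>i\<ge>N. \<forall>j\<ge>N. dist (X i) (X j) < e" "i \<ge> N" "finite F" for e N i F
  proof (rule tendsto_upperbound)
    show "(\<lambda>j. sum (\<lambda>m. (cmod (coord (X i) m - coord (X j) m))\<^sup>2) F)
            \<longlonglongrightarrow> sum (\<lambda>m. (cmod (coord (X i) m - L m))\<^sup>2) F"
      by (intro tendsto_intros L)
    show "\<forall>\<^sub>F j in sequentially. sum (\<lambda>m. (cmod (coord (X i) m - coord (X j) m))\<^sup>2) F \<le> e\<^sup>2"
      unfolding eventually_sequentially
    proof (intro exI allI impI)
      fix j assume "N \<le> j"
      have "sum (\<lambda>m. (cmod (coord (X i - X j) m))\<^sup>2) F \<le> (norm (X i - X j))\<^sup>2"
        unfolding norm_ell2_sq by (rule finite_sum_le_infsum[OF square_summable_coord that(3)]) auto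
      also have "\<dots> \<le> e\<^sup>2"
        using that(1,2) \<open>N \<le> j\<close> by (intro power_mono) (auto simp: dist_norm intro: less_imp_le)
      finally show "sum (\<lambda>m. (cmod (coord (X i) m - coord (X j) m))\<^sup>2) F \<le> e\<^sup>2" by simp
    qed
  qed simp
  have summ: "(\<lambda>m. (cmod (coord (X i) m - L m))\<^sup>2) summable_on UNIV"
    if "\<forall>i\<ge>N. \<forall>j\<ge>N. dist (X i) (X j) < e" "i \<ge> N" for e N i
    by (rule nonneg_bdd_above_summable_on) (auto intro!: bdd_aboveI2[of _ _ "e\<^sup>2"] bound[OF that])
  obtain N where N: "\<forall>i\<ge>N. \<forall>j\<ge>N. dist (X i) (X j) < 1"
    using metric_CauchyD[OF X, of 1] by auto
  \<comment> \<open>\<open>L\<close> is \<open>X N\<close> minus the square-summable difference of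
    \<open>X N\<close> and \<open>L\<close>.\<close>
  have "(\<lambda>m. (cmod (- 1 * (coord (X N) m - L m) + coord (X N) m))\<^sup>2) summable_on UNIV"
    by (intro square_summable_add square_summable_cmult summ[OF N order_refl] square_summable_coord)
  then have coordL: "coord (ell2_of L) = L" by (intro coord_ell2_of) simp
  have "X \<longlonglongrightarrow> ell2_of L"
  proof (rule metric_LIMSEQ_I)
    fix e :: real assume "e > 0"
    then obtain M where M: "\<forall>i\<ge>M. \<forall>j\<ge>M. dist (X i) (X j) < e / 2"
      using metric_CauchyD[OF X, of "e / 2"] by auto
    have "dist (X i) (ell2_of L) < e" if "i \<ge> M" for i
    proof -
      have "(norm (X i - ell2_of L))\<^sup>2 \<le> (e / 2)\<^sup>2"
        unfolding norm_ell2_sq coord_diff coordL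
        by (intro infsum_le_finite_sums summ[OF M that] bound[OF M that])
      then have "norm (X i - ell2_of L) \<le> e / 2"
        by (rule power2_le_imp_le) (use \<open>e > 0\<close> in simp)
      then show ?thesis using \<open>e > 0\<close> by (simp add: dist_norm)
    qed
    then show "\<exists>no. \<forall>n\<ge>no. dist (X n) (ell2_of L) < e" by blast
  qed
  then show "convergent X" by (auto simp: convergent_def)
qed

instance ell2 :: banach ..

lemma cscale_add_right: "cscale c (x + y) = cscale c x + cscale c y"
  and cscale_add_left: "cscale (c + d) x = cscale c x + cscale d x"
  and cscale_cscale: "cscale c (cscale d x) = cscale (c * d) x"
  and cscale_scaleR: "cscale c (r *\<^sub>R x) = r *\<^sub>R cscale c x"
  and cscale_one [simp]: "cscale 1 x = x"
  by (auto intro!: ell2_eqI simp: algebra_simps)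

lemma norm_cscale: "norm (cscale c x) = cmod c * norm x"
proof -
  have "(norm (cscale c x))\<^sup>2 = (cmod c * norm x)\<^sup>2"
    by (simp add: norm_ell2_sq power_mult_distrib norm_mult infsum_cmult_right')
  then show ?thesis by (simp add: power2_eq_iff_nonneg)
qed

lemma inner_cscale_left: "inner (cscale c x) y = inner x (cscale (cnj c) y)"
  unfolding inner_ell2_def by (rule infsum_cong) (simp add: inner_complex_def algebra_simps)

text \<open>Linear in the first and conjugate-linear in the second argument: the real part of <x, i
  y> = -i <x, y> is the imaginary part of <x, y>.\<close>

definition cinner :: "ell2 \<Rightarrow> ell2 \<Rightarrow> complex" where
  "cinner x y = Complex (inner x y) (inner x (cscale \<i> y))"

lemma cinner_add_left: "cinner (x + y) z = cinner x z + cinner y z"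
  and cinner_add_right: "cinner x (y + z) = cinner x y + cinner x z"
  by (auto simp: cinner_def complex_eq_iff inner_add_left inner_add_right cscale_add_right)

lemma cinner_commute: "cinner y x = cnj (cinner x y)"
proof -
  have "inner y (cscale \<i> x) = inner x (cscale (cnj \<i>) y)"
    by (subst inner_commute) (rule inner_cscale_left)
  also have "cscale (cnj \<i>) y = - cscale \<i> y"
    by (auto intro!: ell2_eqI)
  finally show ?thesis by (simp add: cinner_def complex_eq_iff inner_commute)
qed

lemma cscale_Complex: "cscale c x = Re c *\<^sub>R x + Im c *\<^sub>R cscale \<i> x"
  by (intro ell2_eqI) (simp add: complex_eq_iff algebra_simps)

lemma cinner_cscale_left: "cinner (cscale c x) y = c * cinner x y"
proof -
  have 1: "inner (cscale \<i> x) y = - inner x (cscale \<i> y)" for x y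
    using arg_cong[OF cinner_commute[of y x], of Im] by (simp add: cinner_def inner_commute)
  have "cscale \<i> (cscale \<i> y) = - y"
    by (auto intro!: ell2_eqI)
  then show ?thesis
    by (subst cscale_Complex)
       (simp add: cinner_def complex_eq_iff inner_add_left 1 algebra_simps)
qed

lemma cinner_cscale_right: "cinner x (cscale c y) = cnj c * cinner x y"
  by (subst (1 2) cinner_commute) (simp add: cinner_cscale_left)

lemma cscale_zero [simp]: "cscale c 0 = 0"
  by (rule ell2_eqI) simp

lemma cinner_diff_left: "cinner (x - y) z = cinner x z - cinner y z"
  using cinner_add_left[of "x - y" y z] by simp

lemma cinner_zero [simp]: "cinner 0 x = 0" "cinner x 0 = 0"
  by (simp_all add: cinner_def complex_eq_iff)

lemma cinner_sum_left: "cinner (\<Sum>i\<in>A. f i) x = (\<Sum>i\<in>A. cinner (f i) x)"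
  by (induction A rule: infinite_finite_induct) (auto simp: cinner_add_left)

lemma cinner_sum_right: "cinner x (\<Sum>i\<in>A. f i) = (\<Sum>i\<in>A. cinner x (f i))"
  by (induction A rule: infinite_finite_induct) (auto simp: cinner_add_right)

lemma cinner_self: "cinner x x = complex_of_real ((norm x)\<^sup>2)"
proof (rule complex_eqI)
  have "Im (cinner x x) = Im (cnj (cinner x x))"
    by (subst cinner_commute) simp
  then show "Im (cinner x x) = Im (complex_of_real ((norm x)\<^sup>2))" by simp
qed (simp add: cinner_def power2_norm_eq_inner)

definition basis_ell2 :: "nat \<Rightarrow> ell2" where
  "basis_ell2 k = ell2_of (\<lambda>m. if m = k then 1 else 0)"

lemma coord_basis_ell2: "coord (basis_ell2 k) m = (if m = k then 1 else 0)"
proof -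
  have "(\<lambda>m. (cmod (if m = k then 1 else 0))\<^sup>2) summable_on UNIV
      \<longleftrightarrow> (\<lambda>m. (cmod (if m = k then 1 else 0))\<^sup>2) summable_on {k}"
    by (rule summable_on_cong_neutral) auto
  then show ?thesis unfolding basis_ell2_def by (subst coord_ell2_of) auto
qed

lemma cinner_basis_right: "cinner x (basis_ell2 k) = coord x k"
proof -
  \<comment> \<open>The factor \<open>c\<close> is 1 for the real and \<open>\<i>\<close> for the
    imaginary component of \<open>cinner\<close>.\<close>
  have "infsum (\<lambda>m. inner (coord x m) (c * coord (basis_ell2 k) m)) UNIV = inner (coord x k) c" for c
  proof -
    have "infsum (\<lambda>m. inner (coord x m) (c * coord (basis_ell2 k) m)) UNIV
        = infsum (\<lambda>m. inner (coord x m) (c * coord (basis_ell2 k) m)) {k}"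
      by (rule infsum_cong_neutral) (auto simp: coord_basis_ell2)
    then show ?thesis by (simp add: coord_basis_ell2)
  qed
  from this[of 1] this[of \<i>] show ?thesis
    by (simp add: cinner_def inner_ell2_def complex_eq_iff inner_complex_def)
qed

section \<open>Adjointable operators\<close>

type_synonym operator = "ell2 \<Rightarrow>\<^sub>L ell2"

lemma bounded_linear_cscale: "bounded_linear (cscale c)"
  by (rule bounded_linear_intro[where K = "cmod c"])
     (simp_all add: cscale_add_right cscale_scaleR norm_cscale mult.commute)

definition opscale :: "complex \<Rightarrow> operator \<Rightarrow> operator" where
  "opscale c T = Blinfun (cscale c) o\<^sub>L T"

lemma opscale_apply [simp]: "blinfun_apply (opscale c T) x = cscale c (blinfun_apply T x)"
  by (simp add: opscale_def bounded_linear_Blinfun_apply[OF bounded_linear_cscale])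

lemma norm_opscale: "norm (opscale c T) = cmod c * norm T"
proof -
  have le: "norm (opscale c T) \<le> cmod c * norm T" for c T
  proof (rule norm_blinfun_bound)
    fix x show "norm (blinfun_apply (opscale c T) x) \<le> cmod c * norm T * norm x"
      using mult_left_mono[OF norm_blinfun[of T x], of "cmod c"] by (simp add: norm_cscale mult.assoc)
  qed simp
  show ?thesis
  proof (cases "c = 0")
    case False
    have "opscale (inverse c) (opscale c T) = T"
      using False by (intro blinfun_eqI) (simp add: cscale_cscale)
    then have "norm T \<le> inverse (cmod c) * norm (opscale c T)"
      by (metis le norm_inverse)
    then have "cmod c * norm T \<le> norm (opscale c T)"
      using False by (simp add: field_simps)
    then show ?thesis using le[of c T] by simp
  next
    case True
    then have "opscale c T = 0"
      by (intro blinfun_eqI) (auto intro!: ell2_eqI)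
    then show ?thesis using True by simp
  qed
qed

text \<open>A relation between two given operators: every adjoint that occurs is written down
  explicitly or obtained as a limit, so membership in \<open>adjointable\<close> is proved by
  exhibiting the partner.\<close>

definition adjoint_pair :: "operator \<Rightarrow> operator \<Rightarrow> bool" where
  "adjoint_pair T T' \<longleftrightarrow> (\<forall>x y. cinner (blinfun_apply T x) y = cinner x (blinfun_apply T' y))"

definition adjointable :: "operator set" where
  "adjointable = {T. \<exists>T'. adjoint_pair T T'}"

definition adj :: "operator \<Rightarrow> operator" where
  "adj T = (THE T'. adjoint_pair T T')"

lemma adjoint_pairD: "adjoint_pair T T' \<Longrightarrow> cinner (blinfun_apply T x) y = cinner x (blinfun_apply T' y)"
  by (simp add: adjoint_pair_def)

lemma adjoint_pair_sym: "adjoint_pair T T' \<Longrightarrow> adjoint_pair T' T"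
  unfolding adjoint_pair_def using cinner_commute by metis

lemma adjoint_pair_coord:
  assumes "adjoint_pair T T'"
  shows "coord (blinfun_apply T x) m = cinner x (blinfun_apply T' (basis_ell2 m))"
  using adjoint_pairD[OF assms, of x "basis_ell2 m"] by (simp add: cinner_basis_right)

lemma adjoint_pair_unique:
  assumes "adjoint_pair T T1" "adjoint_pair T T2" shows "T1 = T2"
  using assms by (intro blinfun_eqI ell2_eqI) (simp add: adjoint_pair_coord[OF adjoint_pair_sym])

lemma adj_eq: "adjoint_pair T T' \<Longrightarrow> adj T = T'"
  unfolding adj_def using adjoint_pair_unique by blast

lemma adjointableI: "adjoint_pair T T' \<Longrightarrow> T \<in> adjointable"
  by (auto simp: adjointable_def)

lemma adjoint_pair_adj: "T \<in> adjointable \<Longrightarrow> adjoint_pair T (adj T)"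
  by (auto simp: adjointable_def adj_eq)

text \<open>A \<open>blinfun\<close> is a priori only real-linear. The coordinates of
  \<open>T x\<close> are products of \<open>x\<close> with the fixed vectors
  \<open>T' (basis_ell2 m)\<close>, hence complex-linear in \<open>x\<close>.\<close>

lemma adjoint_pair_cscale:
  assumes "adjoint_pair T T'"
  shows "blinfun_apply T (cscale c x) = cscale c (blinfun_apply T x)"
  by (intro ell2_eqI) (simp add: adjoint_pair_coord[OF assms] cinner_cscale_left)

lemma adjoint_pair_zero: "adjoint_pair 0 0"
  and adjoint_pair_id: "adjoint_pair id_blinfun id_blinfun"
  by (auto simp: adjoint_pair_def)

lemma adjoint_pair_add:
  "adjoint_pair S S' \<Longrightarrow> adjoint_pair T T' \<Longrightarrow> adjoint_pair (S + T) (S' + T')"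
  by (auto simp: adjoint_pair_def blinfun.add_left cinner_add_left cinner_add_right)

lemma adjoint_pair_compose:
  "adjoint_pair S S' \<Longrightarrow> adjoint_pair T T' \<Longrightarrow> adjoint_pair (S o\<^sub>L T) (T' o\<^sub>L S')"
  by (auto simp: adjoint_pair_def)

lemma adjoint_pair_opscale:
  assumes "adjoint_pair T T'" shows "adjoint_pair (opscale c T) (opscale (cnj c) T')"
  using assms by (auto simp: adjoint_pair_def cinner_cscale_left cinner_cscale_right)

lemma adjoint_pair_uminus: "adjoint_pair T T' \<Longrightarrow> adjoint_pair (- T) (- T')"
proof -
  have "opscale (-1) T = - T" for T
    by (intro blinfun_eqI ell2_eqI) (simp add: blinfun.minus_left)
  then show "adjoint_pair T T' \<Longrightarrow> adjoint_pair (- T) (- T')"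
    by (metis adjoint_pair_opscale complex_cnj_minus complex_cnj_one)
qed

lemma adjoint_pair_diff:
  "adjoint_pair S S' \<Longrightarrow> adjoint_pair T T' \<Longrightarrow> adjoint_pair (S - T) (S' - T')"
  using adjoint_pair_add[OF _ adjoint_pair_uminus] by simp

lemma adjoint_pair_sum:
  "(\<And>i. i \<in> I \<Longrightarrow> adjoint_pair (f i) (g i)) \<Longrightarrow> adjoint_pair (\<Sum>i\<in>I. f i) (\<Sum>i\<in>I. g i)"
  by (induction I rule: infinite_finite_induct) (auto intro: adjoint_pair_zero adjoint_pair_add)

section \<open>The C*-identity for adjoint pairs\<close>

lemma norm_sq_le_of_adjoint_pair:
  assumes "adjoint_pair T T'"
  shows "(norm (blinfun_apply T x))\<^sup>2 \<le> norm (T' o\<^sub>L T) * (norm x)\<^sup>2"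
proof -
  have "complex_of_real ((norm (blinfun_apply T x))\<^sup>2) = cinner x (blinfun_apply (T' o\<^sub>L T) x)"
    by (simp add: cinner_self[symmetric] adjoint_pairD[OF assms, symmetric] del: of_real_power)
  then have "(norm (blinfun_apply T x))\<^sup>2 = inner x (blinfun_apply (T' o\<^sub>L T) x)"
    by (metis Re_complex_of_real cinner_def complex.sel(1))
  also have "\<dots> \<le> norm x * norm (blinfun_apply (T' o\<^sub>L T) x)"
    by (rule norm_cauchy_schwarz)
  also have "\<dots> \<le> norm x * (norm (T' o\<^sub>L T) * norm x)"
    by (intro mult_left_mono norm_blinfun) simp
  finally show ?thesis by (simp add: power2_eq_square mult_ac)
qed

text \<open>The substantial half of the C*-identity, from Cauchy-Schwarz applied to ||T x||^2 = Re
  <x, T' T x>. It also makes the adjoint isometric, after which submultiplicativity gives the other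
  half.\<close>

lemma norm_sq_le_norm_adjoint_compose:
  assumes "adjoint_pair T T'" shows "(norm T)\<^sup>2 \<le> norm (T' o\<^sub>L T)"
proof -
  have "norm T \<le> sqrt (norm (T' o\<^sub>L T))"
  proof (rule norm_blinfun_bound)
    fix x
    have "norm (blinfun_apply T x) = sqrt ((norm (blinfun_apply T x))\<^sup>2)" by simp
    also have "\<dots> \<le> sqrt (norm (T' o\<^sub>L T) * (norm x)\<^sup>2)"
      by (intro real_sqrt_le_mono norm_sq_le_of_adjoint_pair assms)
    finally show "norm (blinfun_apply T x) \<le> sqrt (norm (T' o\<^sub>L T)) * norm x"
      by (simp add: real_sqrt_mult)
  qed simp
  then have "(norm T)\<^sup>2 \<le> (sqrt (norm (T' o\<^sub>L T)))\<^sup>2"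
    by (intro power_mono) simp_all
  then show ?thesis by simp
qed

lemma norm_adjoint_le:
  assumes "adjoint_pair T T'" shows "norm T \<le> norm T'"
proof (cases "norm T = 0")
  case False
  have "norm T * norm T \<le> norm T' * norm T"
    using norm_sq_le_norm_adjoint_compose[OF assms] norm_blinfun_compose[of T' T]
    by (simp add: power2_eq_square)
  then show ?thesis using False by simp
qed simp

lemma norm_adjoint: "adjoint_pair T T' \<Longrightarrow> norm T' = norm T"
  by (meson adjoint_pair_sym norm_adjoint_le order_antisym)

lemma norm_adjoint_compose: "adjoint_pair T T' \<Longrightarrow> norm (T' o\<^sub>L T) = (norm T)\<^sup>2"
  using norm_sq_le_norm_adjoint_compose[of T T'] norm_adjoint[of T T'] norm_blinfun_compose[of T' T]
  by (simp add: power2_eq_square)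

lemma tendsto_cinner:
  assumes "(f \<longlongrightarrow> x) F" "(g \<longlongrightarrow> y) F"
  shows "((\<lambda>i. cinner (f i) (g i)) \<longlongrightarrow> cinner x y) F"
  unfolding cinner_def
  by (intro tendsto_Complex tendsto_inner assms bounded_linear.tendsto[OF bounded_linear_cscale])

text \<open>Closedness of the relation under joint norm limits; completeness of the algebra rests on
  it.\<close>

lemma adjoint_pair_limit:
  assumes "\<And>i :: nat. adjoint_pair (X i) (Y i)" "X \<longlonglongrightarrow> T" "Y \<longlonglongrightarrow> T'"
  shows "adjoint_pair T T'"
  unfolding adjoint_pair_def
proof (intro allI LIMSEQ_unique)
  fix x y
  show "(\<lambda>i. cinner (blinfun_apply (X i) x) y) \<longlonglongrightarrow> cinner (blinfun_apply T x) y"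
    by (intro tendsto_cinner tendsto_intros blinfun.tendsto assms)
  show "(\<lambda>i. cinner (blinfun_apply (X i) x) y) \<longlonglongrightarrow> cinner x (blinfun_apply T' y)"
    unfolding adjoint_pairD[OF assms(1)] by (intro tendsto_cinner tendsto_intros blinfun.tendsto assms)
qed

section \<open>Coding operators by matrices\<close>

text \<open>A cardinality argument: a real is coded by a set of naturals, a countable array of such
  sets by one set of naturals through \<open>to_nat\<close>, and that set by a real, placed in a 1
  by 1 matrix. The boolean index separates real and imaginary parts.\<close>

lemma inj_complex_mat_matrices:
  "\<exists>h :: (nat \<Rightarrow> nat \<Rightarrow> complex) \<Rightarrow> complex mat. inj h"
proof -
  from nat_sets_eqpoll_reals obtain dec :: "nat set \<Rightarrow> real" where dec: "bij dec"
    unfolding eqpoll_def by auto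
  define enc where "enc = inv_into UNIV dec"
  have enc: "inj enc"
    unfolding enc_def using dec by (simp add: bij_imp_bij_inv bij_is_inj)
  define F where "F f = {to_nat (i, j, b, k) | i j b k.
    k \<in> enc (if b then Re (f i j) else Im (f i j))}" for f :: "nat \<Rightarrow> nat \<Rightarrow> complex"
  have F_iff: "to_nat (i, j, b, k) \<in> F f \<longleftrightarrow> k \<in> enc (if b then Re (f i j) else Im (f i j))" for f i j b k
    unfolding F_def by auto
  have "inj F"
  proof (rule injI)
    fix f g assume "F f = F g"
    then have "enc (if b then Re (f i j) else Im (f i j)) = enc (if b then Re (g i j) else Im (g i j))" for i j b
      using F_iff by blast
    then have eq: "(if b then Re (f i j) else Im (f i j)) = (if b then Re (g i j) else Im (g i j))" for i j b
      using injD[OF enc] by blast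
    show "f = g"
      using eq[of True] eq[of False] by (intro ext complex_eqI) simp_all
  qed
  moreover have "inj (\<lambda>S. Matrix.mat 1 1 (\<lambda>_. complex_of_real (dec S)))"
  proof (rule injI)
    fix S S' :: "nat set"
    assume eq: "Matrix.mat 1 1 (\<lambda>_. complex_of_real (dec S)) = Matrix.mat 1 1 (\<lambda>_. complex_of_real (dec S'))"
    have "dec S = dec S'"
      using arg_cong[OF eq, of "\<lambda>M. M $$ (0, 0)"] by simp
    then show "S = S'" using dec by (simp add: bij_is_inj inj_eq)
  qed
  ultimately show ?thesis using inj_compose by blast
qed

text \<open>The matrix entries determine the adjoint on the basis vectors, and coordinate
  \<open>m\<close> of \<open>T x\<close> is the product of \<open>x\<close> with
  \<open>adj T (basis_ell2 m)\<close>. This replaces an argument by density of the span of the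
  basis.\<close>

lemma inj_on_matrix_of_operator:
  "inj_on (\<lambda>T i j. coord (blinfun_apply T (basis_ell2 j)) i) adjointable"
proof (rule inj_onI)
  fix S T assume ST: "S \<in> adjointable" "T \<in> adjointable"
    and eq: "(\<lambda>i j. coord (blinfun_apply S (basis_ell2 j)) i) = (\<lambda>i j. coord (blinfun_apply T (basis_ell2 j)) i)"
  have *: "coord (blinfun_apply (adj R) (basis_ell2 m)) j = cnj (coord (blinfun_apply R (basis_ell2 j)) m)"
    if "R \<in> adjointable" for R m j
    using adjoint_pair_coord[OF adjoint_pair_adj[OF that], of "basis_ell2 j" m]
    by (metis cinner_basis_right cinner_commute)
  have "adj S = adj T \<or> blinfun_apply (adj S) (basis_ell2 m) = blinfun_apply (adj T) (basis_ell2 m)" for m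
    using *[OF ST(1)] *[OF ST(2)] fun_cong[OF fun_cong[OF eq]] by (intro disjI2 ell2_eqI) simp
  then have "blinfun_apply (adj S) (basis_ell2 m) = blinfun_apply (adj T) (basis_ell2 m)" for m by metis
  then show "S = T"
    by (intro blinfun_eqI ell2_eqI) (simp add: adjoint_pair_coord[OF adjoint_pair_adj] ST)
qed

lemma inj_on_adjointable_complex_mat: "\<exists>h :: operator \<Rightarrow> complex mat. inj_on h adjointable"
proof -
  obtain g :: "(nat \<Rightarrow> nat \<Rightarrow> complex) \<Rightarrow> complex mat" where "inj g"
    using inj_complex_mat_matrices by blast
  then show ?thesis
    using comp_inj_on[OF inj_on_matrix_of_operator, of g] inj_on_subset by blast
qed

definition op_code :: "operator \<Rightarrow> complex mat" where
  "op_code = (SOME h. inj_on h adjointable)"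

definition op_decode :: "complex mat \<Rightarrow> operator" where
  "op_decode = inv_into adjointable op_code"

lemma op_decode_code [simp]: "T \<in> adjointable \<Longrightarrow> op_decode (op_code T) = T"
  unfolding op_decode_def op_code_def
  by (rule inv_into_f_f[OF someI_ex[OF inj_on_adjointable_complex_mat]])

text \<open>Transport of structure along the injection \<open>op_code\<close>; the operations have
  no relation to those of the matrices that serve as codes.\<close>

definition op_cstar :: "complex mat cstar" where
  "op_cstar = \<lparr> carrier = op_code ` adjointable,
     mult = (\<lambda>x y. op_code (op_decode x o\<^sub>L op_decode y)),
     one = op_code id_blinfun,
     zero = op_code 0,
     add = (\<lambda>x y. op_code (op_decode x + op_decode y)),
     smult = (\<lambda>c x. op_code (opscale c (op_decode x))),
     star = (\<lambda>x. op_code (adj (op_decode x))),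
     cnorm = (\<lambda>x. norm (op_decode x)) \<rparr>"

lemma adjointable_closed [simp, intro]:
  "0 \<in> adjointable" "id_blinfun \<in> adjointable"
  "T \<in> adjointable \<Longrightarrow> adj T \<in> adjointable"
  "S \<in> adjointable \<Longrightarrow> T \<in> adjointable \<Longrightarrow> S + T \<in> adjointable"
  "S \<in> adjointable \<Longrightarrow> T \<in> adjointable \<Longrightarrow> S - T \<in> adjointable"
  "S \<in> adjointable \<Longrightarrow> T \<in> adjointable \<Longrightarrow> S o\<^sub>L T \<in> adjointable"
  "T \<in> adjointable \<Longrightarrow> - T \<in> adjointable"
  "T \<in> adjointable \<Longrightarrow> opscale c T \<in> adjointable"
  by (blast intro: adjointableI adjoint_pair_zero adjoint_pair_id adjoint_pair_adj adjoint_pair_sym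
      adjoint_pair_add adjoint_pair_diff adjoint_pair_compose adjoint_pair_uminus adjoint_pair_opscale)+

lemma op_cstar_carrierE:
  assumes "x \<in> carrier op_cstar"
  obtains T where "T \<in> adjointable" "x = op_code T"
  using assms by (auto simp: op_cstar_def)

section \<open>The C*-algebra axioms for coded operators\<close>

lemma op_code_carrier [simp]: "T \<in> adjointable \<Longrightarrow> op_code T \<in> carrier op_cstar"
  by (simp add: op_cstar_def)

lemma op_cstar_one [simp]: "\<one>\<^bsub>op_cstar\<^esub> = op_code id_blinfun"
  and op_cstar_zero [simp]: "\<zero>\<^bsub>op_cstar\<^esub> = op_code 0"
  by (simp_all add: op_cstar_def)

lemma op_cstar_binary [simp]:
  assumes "S \<in> adjointable" "T \<in> adjointable"
  shows "op_code S \<otimes>\<^bsub>op_cstar\<^esub> op_code T = op_code (S o\<^sub>L T)"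
    and "op_code S \<oplus>\<^bsub>op_cstar\<^esub> op_code T = op_code (S + T)"
  using assms by (simp_all add: op_cstar_def)

lemma op_cstar_unary [simp]:
  assumes "T \<in> adjointable"
  shows "c \<odot>\<^bsub>op_cstar\<^esub> op_code T = op_code (opscale c T)"
    and "star op_cstar (op_code T) = op_code (adj T)"
    and "cnorm op_cstar (op_code T) = norm T"
  using assms by (simp_all add: op_cstar_def)

lemma abelian_group_op_cstar: "abelian_group op_cstar"
proof (rule abelian_groupI)
  fix x assume "x \<in> carrier op_cstar"
  then obtain T where T: "T \<in> adjointable" "x = op_code T" by (rule op_cstar_carrierE)
  then show "\<exists>y\<in>carrier op_cstar. y \<oplus>\<^bsub>op_cstar\<^esub> x = \<zero>\<^bsub>op_cstar\<^esub>"
    by (intro bexI[of _ "op_code (- T)"]) simp_all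
qed (auto elim!: op_cstar_carrierE simp: algebra_simps)

lemma ring_op_cstar: "Ring.ring op_cstar"
proof (rule ringI[OF abelian_group_op_cstar])
  show "monoid op_cstar"
    by (rule monoidI)
       (auto elim!: op_cstar_carrierE intro!: arg_cong[of _ _ op_code] blinfun_eqI)
qed (auto elim!: op_cstar_carrierE simp: blinfun.add_left blinfun.add_right
      intro!: arg_cong[of _ _ op_code] blinfun_eqI)

lemma op_cstar_minus:
  assumes "S \<in> adjointable" "T \<in> adjointable"
  shows "op_code S \<ominus>\<^bsub>op_cstar\<^esub> op_code T = op_code (S - T)"
proof -
  interpret abelian_group op_cstar by (rule abelian_group_op_cstar)
  have "\<ominus>\<^bsub>op_cstar\<^esub> op_code T = op_code (- T)"
    by (rule minus_equality) (use assms in simp_all)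
  then show ?thesis using assms by (simp add: a_minus_def)
qed

lemma op_cstar_inv:
  assumes "S \<in> adjointable" "T \<in> adjointable" "S o\<^sub>L T = id_blinfun" "T o\<^sub>L S = id_blinfun"
  shows "inv\<^bsub>op_cstar\<^esub> op_code S = op_code T"
proof -
  interpret Ring.ring op_cstar by (rule ring_op_cstar)
  show ?thesis by (rule inv_char) (use assms in simp_all)
qed

lemma module_op_cstar: "Module.module (class_ring :: complex Ring.ring) op_cstar"
proof (rule moduleI[OF _ abelian_group_op_cstar])
  show "cring (class_ring :: complex Ring.ring)" by (rule class_cring.is_cring)
qed (auto elim!: op_cstar_carrierE simp: cscale_add_left cscale_add_right cscale_cscale blinfun.add_left
      intro!: arg_cong[of _ _ op_code] blinfun_eqI)

lemma op_cstar_complete: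
  assumes "range X \<subseteq> carrier op_cstar"
    and "\<forall>e>0. \<exists>N. \<forall>i\<ge>N. \<forall>j\<ge>N. cnorm op_cstar (X i \<ominus>\<^bsub>op_cstar\<^esub> X j) < e"
  shows "\<exists>x\<in>carrier op_cstar. (\<lambda>i::nat. cnorm op_cstar (X i \<ominus>\<^bsub>op_cstar\<^esub> x)) \<longlonglongrightarrow> 0"
proof -
  have "\<forall>i. \<exists>T\<in>adjointable. X i = op_code T"
    using assms(1) by (metis op_cstar_carrierE range_subsetD)
  then obtain Y where Y: "\<And>i. Y i \<in> adjointable" "\<And>i. X i = op_code (Y i)" by metis
  have norm: "cnorm op_cstar (X i \<ominus>\<^bsub>op_cstar\<^esub> op_code T) = norm (Y i - T)" if "T \<in> adjointable" for i T
    using that Y by (simp add: op_cstar_minus)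
  have *: "\<exists>N. \<forall>i\<ge>N. \<forall>j\<ge>N. dist (Y i) (Y j) < e" if "e > 0" for e
    using assms(2) that norm[OF Y(1)] by (simp add: Y(2) dist_norm)
  then have "Cauchy Y" by (simp add: Cauchy_def)
  then obtain T where T: "Y \<longlonglongrightarrow> T" using Cauchy_convergent convergent_def by blast
  \<comment> \<open>The adjoint is isometric, so the adjoints form a Cauchy sequence too; their
    limit is the partner that makes \<open>T\<close> adjointable.\<close>
  have "dist (adj (Y i)) (adj (Y j)) = dist (Y i) (Y j)" for i j
    unfolding dist_norm by (intro norm_adjoint adjoint_pair_diff adjoint_pair_adj Y)
  then have "Cauchy (\<lambda>i. adj (Y i))" using * by (simp add: Cauchy_def)
  then obtain T' where T': "(\<lambda>i. adj (Y i)) \<longlonglongrightarrow> T'" using Cauchy_convergent convergent_def by blast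
  have "adjoint_pair T T'"
    by (rule adjoint_pair_limit[OF adjoint_pair_adj T T']) (rule Y)
  then have "T \<in> adjointable" by (rule adjointableI)
  moreover have "(\<lambda>i. norm (Y i - T)) \<longlonglongrightarrow> 0"
    using T by (simp add: LIM_zero tendsto_norm_zero)
  ultimately show ?thesis
    by (intro bexI[of _ "op_code T"]) (simp_all add: norm)
qed

lemma cstar_algebra_op_cstar: "cstar_algebra op_cstar"
proof (rule cstar_algebra.intro)
  fix x y c assume "x \<in> carrier op_cstar" "y \<in> carrier op_cstar"
  then obtain S T where ST: "S \<in> adjointable" "x = op_code S" "T \<in> adjointable" "y = op_code T"
    by (metis op_cstar_carrierE)
  have pair: "adjoint_pair S (adj S)" "adjoint_pair T (adj T)"
    using ST by (auto intro: adjoint_pair_adj)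
  show "(c \<odot>\<^bsub>op_cstar\<^esub> x) \<otimes>\<^bsub>op_cstar\<^esub> y = c \<odot>\<^bsub>op_cstar\<^esub> (x \<otimes>\<^bsub>op_cstar\<^esub> y)"
    using ST by (auto intro!: arg_cong[of _ _ op_code] blinfun_eqI)
  show "x \<otimes>\<^bsub>op_cstar\<^esub> (c \<odot>\<^bsub>op_cstar\<^esub> y) = c \<odot>\<^bsub>op_cstar\<^esub> (x \<otimes>\<^bsub>op_cstar\<^esub> y)"
    using ST by (auto intro!: arg_cong[of _ _ op_code] blinfun_eqI simp: adjoint_pair_cscale[OF pair(1)])
  show "star op_cstar (x \<oplus>\<^bsub>op_cstar\<^esub> y) = star op_cstar x \<oplus>\<^bsub>op_cstar\<^esub> star op_cstar y"
    using ST by (simp add: adj_eq[OF adjoint_pair_add[OF pair]])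
  show "star op_cstar (x \<otimes>\<^bsub>op_cstar\<^esub> y) = star op_cstar y \<otimes>\<^bsub>op_cstar\<^esub> star op_cstar x"
    using ST by (simp add: adj_eq[OF adjoint_pair_compose[OF pair]])
  show "cnorm op_cstar (x \<oplus>\<^bsub>op_cstar\<^esub> y) \<le> cnorm op_cstar x + cnorm op_cstar y"
    using ST by (simp add: norm_triangle_ineq)
  show "cnorm op_cstar (x \<otimes>\<^bsub>op_cstar\<^esub> y) \<le> cnorm op_cstar x * cnorm op_cstar y"
    using ST by (simp add: norm_blinfun_compose)
next
  fix x c assume "x \<in> carrier op_cstar"
  then obtain T where T: "T \<in> adjointable" "x = op_code T" by (rule op_cstar_carrierE)
  have pair: "adjoint_pair T (adj T)" using T by (auto intro: adjoint_pair_adj)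
  show "star op_cstar x \<in> carrier op_cstar" using T by simp
  show "star op_cstar (star op_cstar x) = x"
    using T by (simp add: adj_eq[OF adjoint_pair_sym[OF pair]])
  show "star op_cstar (c \<odot>\<^bsub>op_cstar\<^esub> x) = cnj c \<odot>\<^bsub>op_cstar\<^esub> star op_cstar x"
    using T by (simp add: adj_eq[OF adjoint_pair_opscale[OF pair]])
  show "0 \<le> cnorm op_cstar x" using T by simp
  show "cnorm op_cstar x = 0 \<longleftrightarrow> x = \<zero>\<^bsub>op_cstar\<^esub>"
    using T by simp (metis adjointable_closed(1) op_decode_code)
  show "cnorm op_cstar (c \<odot>\<^bsub>op_cstar\<^esub> x) = cmod c * cnorm op_cstar x"
    using T by (simp add: norm_opscale)
  show "cnorm op_cstar (star op_cstar x \<otimes>\<^bsub>op_cstar\<^esub> x) = (cnorm op_cstar x)\<^sup>2"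
    using T by (simp add: norm_adjoint_compose[OF pair])
qed (fact ring_op_cstar module_op_cstar op_cstar_complete)+

section \<open>Partial reindexing operators\<close>

text \<open>For \<open>g\<close> injective on \<open>A\<close> this is a partial isometry; matrix
  units, shift and coshift are all of this kind, so boundedness and adjoints are treated
  once.\<close>

definition reindex :: "nat set \<Rightarrow> (nat \<Rightarrow> nat) \<Rightarrow> ell2 \<Rightarrow> ell2" where
  "reindex A g x = ell2_of (\<lambda>m. if m \<in> A then coord x (g m) else 0)"

definition reindex_op :: "nat set \<Rightarrow> (nat \<Rightarrow> nat) \<Rightarrow> operator" where
  "reindex_op A g = Blinfun (reindex A g)"

lemma square_summable_reindex:
  assumes "inj_on g A"
  shows "(\<lambda>m. (cmod (coord x (g m)))\<^sup>2) summable_on A"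
    and "infsum (\<lambda>m. (cmod (coord x (g m)))\<^sup>2) A \<le> (norm x)\<^sup>2"
proof -
  have s: "(\<lambda>k. (cmod (coord x k))\<^sup>2) summable_on g ` A"
    by (rule summable_on_subset_banach[OF square_summable_coord]) simp
  then show "(\<lambda>m. (cmod (coord x (g m)))\<^sup>2) summable_on A"
    by (subst (asm) summable_on_reindex[OF assms]) (simp add: o_def)
  have "infsum (\<lambda>m. (cmod (coord x (g m)))\<^sup>2) A = infsum (\<lambda>k. (cmod (coord x k))\<^sup>2) (g ` A)"
    by (subst infsum_reindex[OF assms]) (simp add: o_def)
  also have "\<dots> \<le> (norm x)\<^sup>2"
    unfolding norm_ell2_sq by (rule infsum_mono2[OF s square_summable_coord]) auto
  finally show "infsum (\<lambda>m. (cmod (coord x (g m)))\<^sup>2) A \<le> (norm x)\<^sup>2" .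
qed

lemma coord_reindex:
  assumes "inj_on g A"
  shows "coord (reindex A g x) m = (if m \<in> A then coord x (g m) else 0)"
proof -
  have "(\<lambda>m. (cmod (if m \<in> A then coord x (g m) else 0))\<^sup>2) summable_on UNIV
      \<longleftrightarrow> (\<lambda>m. (cmod (coord x (g m)))\<^sup>2) summable_on A"
    by (rule summable_on_cong_neutral) auto
  then show ?thesis
    unfolding reindex_def by (subst coord_ell2_of) (use square_summable_reindex[OF assms] in auto)
qed

lemma bounded_linear_reindex:
  assumes "inj_on g A" shows "bounded_linear (reindex A g)"
proof (rule bounded_linear_intro[where K = 1])
  fix x
  have "(norm (reindex A g x))\<^sup>2 = infsum (\<lambda>m. (cmod (coord x (g m)))\<^sup>2) A"
    unfolding norm_ell2_sq by (rule infsum_cong_neutral) (auto simp: coord_reindex[OF assms])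
  then have "(norm (reindex A g x))\<^sup>2 \<le> (norm x)\<^sup>2"
    using square_summable_reindex(2)[OF assms] by simp
  then show "norm (reindex A g x) \<le> norm x * 1"
    using power2_le_imp_le by simp
qed (auto intro!: ell2_eqI simp: coord_reindex[OF assms])

lemma coord_reindex_op:
  assumes "inj_on g A"
  shows "coord (blinfun_apply (reindex_op A g) x) m = (if m \<in> A then coord x (g m) else 0)"
  by (simp add: reindex_op_def bounded_linear_Blinfun_apply[OF bounded_linear_reindex[OF assms]]
      coord_reindex[OF assms])

text \<open>The adjoint reindexes along the inverse bijection: substitute \<open>g\<close> in the
  sum that defines the inner product.\<close>

lemma adjoint_pair_reindex_op:
  assumes g: "bij_betw g A B" and h: "\<And>m. m \<in> A \<Longrightarrow> h (g m) = m"
  shows "adjoint_pair (reindex_op A g) (reindex_op B h)"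
proof -
  have "inj_on g A" using g by (rule bij_betw_imp_inj_on)
  moreover have "inj_on h B"
  proof (rule inj_onI)
    fix k l assume "k \<in> B" "l \<in> B" "h k = h l"
    moreover from this obtain m m' where "m \<in> A" "k = g m" "m' \<in> A" "l = g m'"
      using g by (auto simp: bij_betw_def)
    ultimately show "k = l" using h by simp
  qed
  ultimately have coords:
    "coord (blinfun_apply (reindex_op A g) x) m = (if m \<in> A then coord x (g m) else 0)"
    "coord (blinfun_apply (reindex_op B h) x) m = (if m \<in> B then coord x (h m) else 0)" for x m
    by (simp_all add: coord_reindex_op)
  have real: "inner (blinfun_apply (reindex_op A g) x) y = inner x (blinfun_apply (reindex_op B h) y)" for x y
  proof -
    have "inner (blinfun_apply (reindex_op A g) x) y = infsum (\<lambda>m. inner (coord x (g m)) (coord y (h (g m)))) A"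
      unfolding inner_ell2_def by (rule infsum_cong_neutral) (auto simp: coords h)
    also have "\<dots> = infsum (\<lambda>k. inner (coord x k) (coord y (h k))) B"
      by (rule infsum_reindex_bij_betw[OF g])
    also have "\<dots> = inner x (blinfun_apply (reindex_op B h) y)"
      unfolding inner_ell2_def by (rule infsum_cong_neutral) (auto simp: coords)
    finally show ?thesis .
  qed
  \<comment> \<open>Commutation with \<open>\<i>\<close> lifts the identity from
    \<open>inner\<close> to both components of \<open>cinner\<close>.\<close>
  have "blinfun_apply (reindex_op B h) (cscale \<i> y) = cscale \<i> (blinfun_apply (reindex_op B h) y)" for y
    by (rule ell2_eqI) (simp add: coords)
  then show ?thesis
    unfolding adjoint_pair_def cinner_def by (simp add: real)
qed

section \<open>Matrices acting on blocks\<close>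

text \<open>The coordinate \<open>k * n + i\<close> with \<open>i < n\<close> is read as the \<open>i\<close>-th coordinate of the \<open>k\<close>-th
  block, so that the space of sequences becomes $\mathbb{C}^n \otimes \ell^2$.\<close>

definition mat_unit_op :: "nat \<Rightarrow> nat \<Rightarrow> nat \<Rightarrow> operator" where
  "mat_unit_op n i j = reindex_op {m. m mod n = i} (\<lambda>m. m div n * n + j)"

text \<open>The operator b \<otimes> 1, assembled from e_ij \<otimes> 1.\<close>

definition mat_op :: "nat \<Rightarrow> complex mat \<Rightarrow> operator" where
  "mat_op n b = (\<Sum>i<n. \<Sum>j<n. opscale (b $$ (i, j)) (mat_unit_op n i j))"

definition shift_op :: "nat \<Rightarrow> operator" where
  "shift_op n = reindex_op {n..} (\<lambda>m. m - n)"

definition coshift_op :: "nat \<Rightarrow> operator" where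
  "coshift_op n = reindex_op UNIV (\<lambda>m. m + n)"

lemma block_index [simp]:
  fixes i k n :: nat
  assumes "i < n"
  shows "(k * n + i) div n = k" "(k * n + i) mod n = i"
  using assms by simp_all

lemma bij_betw_block:
  fixes i j n :: nat
  assumes "i < n" "j < n"
  shows "bij_betw (\<lambda>m. m div n * n + j) {m. m mod n = i} {m. m mod n = j}"
  by (rule bij_betw_byWitness[where f' = "\<lambda>m. m div n * n + i"])
     (use assms in \<open>auto simp: div_mult_mod_eq\<close>)

lemma adjoint_pair_mat_unit_op:
  assumes "i < n" "j < n"
  shows "adjoint_pair (mat_unit_op n i j) (mat_unit_op n j i)"
  unfolding mat_unit_op_def
  by (rule adjoint_pair_reindex_op[OF bij_betw_block[OF assms]]) (use assms in auto)

lemma adjoint_pair_shift_op: "adjoint_pair (shift_op n) (coshift_op n)"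
  unfolding shift_op_def coshift_op_def
  by (rule adjoint_pair_reindex_op) (auto intro!: bij_betw_byWitness[where f' = "\<lambda>m. m + n"])

lemma coord_shift_op [simp]:
  "coord (blinfun_apply (shift_op n) x) m = (if n \<le> m then coord x (m - n) else 0)"
  unfolding shift_op_def by (subst coord_reindex_op) (auto intro: inj_onI)

lemma coord_coshift_op [simp]: "coord (blinfun_apply (coshift_op n) x) m = coord x (m + n)"
  unfolding coshift_op_def by (subst coord_reindex_op) auto

lemma coord_sum: "coord (\<Sum>i\<in>I. f i) m = (\<Sum>i\<in>I. coord (f i) m)"
  by (induction I rule: infinite_finite_induct) auto

lemma coord_mat_op:
  assumes "n > 0"
  shows "coord (blinfun_apply (mat_op n b) x) m = (\<Sum>j<n. b $$ (m mod n, j) * coord x (m div n * n + j))"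
proof -
  have unit: "coord (blinfun_apply (mat_unit_op n i j) x) m = (if m mod n = i then coord x (m div n * n + j) else 0)"
    if "i < n" "j < n" for i j
    unfolding mat_unit_op_def
    by (subst coord_reindex_op[OF bij_betw_imp_inj_on[OF bij_betw_block[OF that]]]) simp
  have "coord (blinfun_apply (mat_op n b) x) m
      = (\<Sum>i<n. \<Sum>j<n. if m mod n = i then b $$ (i, j) * coord x (m div n * n + j) else 0)"
    unfolding mat_op_def blinfun.sum_left coord_sum by (intro sum.cong refl) (simp add: unit)
  also have "\<dots> = (\<Sum>i<n. if m mod n = i then \<Sum>j<n. b $$ (i, j) * coord x (m div n * n + j) else 0)"
    by (intro sum.cong refl) simp
  also have "\<dots> = (\<Sum>j<n. b $$ (m mod n, j) * coord x (m div n * n + j))"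
    using assms by simp
  finally show ?thesis .
qed

lemma mat_adjoint_carrier [simp]: "b \<in> carrier_mat n m \<Longrightarrow> mat_adjoint b \<in> carrier_mat m n"
  by (auto simp: mat_adjoint_def)

lemma index_mat_adjoint:
  fixes b :: "complex mat"
  shows "b \<in> carrier_mat n m \<Longrightarrow> i < m \<Longrightarrow> j < n \<Longrightarrow> mat_adjoint b $$ (i, j) = cnj (b $$ (j, i))"
  by (auto simp: mat_adjoint_def mat_of_rows_def)

lemma adjoint_pair_mat_op:
  assumes "b \<in> carrier_mat n n"
  shows "adjoint_pair (mat_op n b) (mat_op n (mat_adjoint b))"
proof -
  have "adjoint_pair (mat_op n b) (\<Sum>i<n. \<Sum>j<n. opscale (cnj (b $$ (i, j))) (mat_unit_op n j i))"
    unfolding mat_op_def by (intro adjoint_pair_sum adjoint_pair_opscale adjoint_pair_mat_unit_op) auto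
  also have "(\<Sum>i<n. \<Sum>j<n. opscale (cnj (b $$ (i, j))) (mat_unit_op n j i)) = mat_op n (mat_adjoint b)"
    unfolding mat_op_def by (subst sum.swap) (intro sum.cong refl, simp add: index_mat_adjoint[OF assms])
  finally show ?thesis .
qed

lemma mat_op_adjointable: "b \<in> carrier_mat n n \<Longrightarrow> mat_op n b \<in> adjointable"
  by (rule adjointableI[OF adjoint_pair_mat_op])

lemma index_mult_mat_sum:
  "A \<in> carrier_mat n k \<Longrightarrow> B \<in> carrier_mat k m \<Longrightarrow> i < n \<Longrightarrow> j < m
    \<Longrightarrow> (A * B) $$ (i, j) = (\<Sum>l<k. A $$ (i, l) * B $$ (l, j))"
  by (auto simp: scalar_prod_def atLeast0LessThan intro!: sum.cong)

lemma mat_op_add: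
  assumes "b \<in> carrier_mat n n" "c \<in> carrier_mat n n" "n > 0"
  shows "mat_op n (b + c) = mat_op n b + mat_op n c"
proof (intro blinfun_eqI ell2_eqI)
  fix x m
  show "coord (blinfun_apply (mat_op n (b + c)) x) m = coord (blinfun_apply (mat_op n b + mat_op n c) x) m"
    unfolding blinfun.add_left coord_add coord_mat_op[OF assms(3)] sum.distrib[symmetric]
    by (intro sum.cong refl) (use assms in \<open>simp add: distrib_right\<close>)
qed

lemma mat_op_diff:
  assumes "b \<in> carrier_mat n n" "c \<in> carrier_mat n n" "n > 0"
  shows "mat_op n (b - c) = mat_op n b - mat_op n c"
proof (intro blinfun_eqI ell2_eqI)
  fix x m
  show "coord (blinfun_apply (mat_op n (b - c)) x) m = coord (blinfun_apply (mat_op n b - mat_op n c) x) m"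
    unfolding blinfun.diff_left coord_diff coord_mat_op[OF assms(3)] sum_subtractf[symmetric]
    by (intro sum.cong refl) (use assms in \<open>simp add: left_diff_distrib\<close>)
qed

lemma mat_op_smult:
  assumes "b \<in> carrier_mat n n" "n > 0"
  shows "mat_op n (z \<cdot>\<^sub>m b) = opscale z (mat_op n b)"
proof (intro blinfun_eqI ell2_eqI)
  fix x m
  show "coord (blinfun_apply (mat_op n (z \<cdot>\<^sub>m b)) x) m = coord (blinfun_apply (opscale z (mat_op n b)) x) m"
    unfolding opscale_apply coord_cscale coord_mat_op[OF assms(2)] sum_distrib_left
    by (intro sum.cong refl) (use assms in \<open>simp add: mult.assoc\<close>)
qed

lemma mat_op_one: "n > 0 \<Longrightarrow> mat_op n (1\<^sub>m n) = id_blinfun"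
proof (intro blinfun_eqI ell2_eqI)
  fix x m assume "n > 0"
  then have "(\<Sum>j<n. 1\<^sub>m n $$ (m mod n, j) * coord x (m div n * n + j))
      = (\<Sum>j<n. if j = m mod n then coord x (m div n * n + j) else 0)"
    by (intro sum.cong refl) auto
  then show "coord (blinfun_apply (mat_op n (1\<^sub>m n)) x) m = coord (blinfun_apply id_blinfun x) m"
    using \<open>n > 0\<close> by (simp add: coord_mat_op)
qed

lemma mat_op_mult:
  assumes "b \<in> carrier_mat n n" "c \<in> carrier_mat n n" "n > 0"
  shows "mat_op n (b * c) = mat_op n b o\<^sub>L mat_op n c"
proof (intro blinfun_eqI ell2_eqI)
  fix x m
  have "coord (blinfun_apply (mat_op n (b * c)) x) m
      = (\<Sum>l<n. \<Sum>j<n. b $$ (m mod n, j) * (c $$ (j, l) * coord x (m div n * n + l)))"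
    using assms by (simp add: coord_mat_op index_mult_mat_sum[OF assms(1,2)] sum_distrib_right mult.assoc
        del: index_mult_mat)
  also have "\<dots> = (\<Sum>j<n. \<Sum>l<n. b $$ (m mod n, j) * (c $$ (j, l) * coord x (m div n * n + l)))"
    by (rule sum.swap)
  also have "\<dots> = coord (blinfun_apply (mat_op n b o\<^sub>L mat_op n c) x) m"
    using assms(3) by (simp add: coord_mat_op sum_distrib_left)
  finally show "coord (blinfun_apply (mat_op n (b * c)) x) m = coord (blinfun_apply (mat_op n b o\<^sub>L mat_op n c) x) m" .
qed

text \<open>The operators b \<otimes> 1 preserve the vacuum block, the coordinates below
  \<open>n\<close>; this makes the compression to that block a bimodule map.\<close>

lemma mat_op_basis:
  assumes "n > 0" "j < n"
  shows "blinfun_apply (mat_op n b) (basis_ell2 j) = (\<Sum>l<n. cscale (b $$ (l, j)) (basis_ell2 l))"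
proof (rule ell2_eqI)
  fix m
  have "coord (blinfun_apply (mat_op n b) (basis_ell2 j)) m
      = (\<Sum>l<n. if l = j then (if m div n = 0 then b $$ (m mod n, j) else 0) else 0)"
    unfolding coord_mat_op[OF assms(1)]
  proof (intro sum.cong refl)
    fix l assume "l \<in> {..<n}"
    then have "m div n * n + l = j \<longleftrightarrow> l = j \<and> m div n = 0"
      using assms by (cases "m div n") auto
    then show "b $$ (m mod n, l) * coord (basis_ell2 j) (m div n * n + l)
        = (if l = j then (if m div n = 0 then b $$ (m mod n, j) else 0) else 0)"
      by (simp add: coord_basis_ell2)
  qed
  also have "\<dots> = (if m < n then b $$ (m, j) else 0)"
    using assms by (simp add: div_eq_0_iff)
  also have "\<dots> = coord (\<Sum>l<n. cscale (b $$ (l, j)) (basis_ell2 l)) m"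
    by (simp add: coord_sum coord_basis_ell2 if_distrib[of "\<lambda>x. _ * x"] cong: if_cong)
  finally show "coord (blinfun_apply (mat_op n b) (basis_ell2 j)) m = coord (\<Sum>l<n. cscale (b $$ (l, j)) (basis_ell2 l)) m" .
qed

section \<open>The vacuum expectation\<close>

text \<open>Compression to block 0, that is, the identity of the matrices tensored with the vacuum
  state.\<close>

definition vacuum_exp :: "nat \<Rightarrow> operator \<Rightarrow> complex mat" where
  "vacuum_exp n T = Matrix.mat n n (\<lambda>(i, j). coord (blinfun_apply T (basis_ell2 j)) i)"

lemma vacuum_exp_carrier [simp]: "vacuum_exp n T \<in> carrier_mat n n"
  by (simp add: vacuum_exp_def)

lemma index_vacuum_exp [simp]:
  "i < n \<Longrightarrow> j < n \<Longrightarrow> vacuum_exp n T $$ (i, j) = coord (blinfun_apply T (basis_ell2 j)) i"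
  by (simp add: vacuum_exp_def)

lemma vacuum_exp_dim [simp]: "dim_row (vacuum_exp n T) = n" "dim_col (vacuum_exp n T) = n"
  by (simp_all add: vacuum_exp_def)

lemma vacuum_exp_mat_op:
  assumes "b \<in> carrier_mat n n" "n > 0"
  shows "vacuum_exp n (mat_op n b) = b"
  by (rule eq_matI)
     (use assms in \<open>auto simp: mat_op_basis coord_sum coord_basis_ell2 if_distrib[of "\<lambda>x. _ * x"] cong: if_cong\<close>)

lemma vacuum_exp_bimodule:
  assumes "T \<in> adjointable" "b \<in> carrier_mat n n" "c \<in> carrier_mat n n" "n > 0"
  shows "vacuum_exp n (mat_op n b o\<^sub>L T o\<^sub>L mat_op n c) = b * vacuum_exp n T * c"
proof (rule eq_matI)
  fix i j assume "i < dim_row (b * vacuum_exp n T * c)" "j < dim_col (b * vacuum_exp n T * c)"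
  then have ij: "i < n" "j < n" using assms by auto
  have T: "blinfun_apply T (blinfun_apply (mat_op n c) (basis_ell2 j))
      = (\<Sum>l<n. cscale (c $$ (l, j)) (blinfun_apply T (basis_ell2 l)))"
    by (simp add: mat_op_basis assms ij blinfun.sum_right adjoint_pair_cscale[OF adjoint_pair_adj[OF assms(1)]])
  have "vacuum_exp n (mat_op n b o\<^sub>L T o\<^sub>L mat_op n c) $$ (i, j)
      = (\<Sum>k<n. b $$ (i, k) * (\<Sum>l<n. c $$ (l, j) * coord (blinfun_apply T (basis_ell2 l)) k))"
    using ij assms by (simp add: T coord_mat_op coord_sum)
  also have "\<dots> = (\<Sum>l<n. (\<Sum>k<n. b $$ (i, k) * coord (blinfun_apply T (basis_ell2 l)) k) * c $$ (l, j))"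
    by (simp add: sum_distrib_left sum_distrib_right mult_ac) (rule sum.swap)
  also have "\<dots> = (b * vacuum_exp n T * c) $$ (i, j)"
    using ij assms
    by (subst index_mult_mat_sum[of _ n n _ n])
       (auto simp: index_mult_mat_sum[of b n n "vacuum_exp n T" n] simp del: index_mult_mat(1) intro!: sum.cong)
  finally show "vacuum_exp n (mat_op n b o\<^sub>L T o\<^sub>L mat_op n c) $$ (i, j) = (b * vacuum_exp n T * c) $$ (i, j)" .
qed (use assms in auto)

lemma sesquilinear_form_sum:
  fixes P :: "complex mat"
  assumes "P \<in> carrier_mat n n" "v \<in> carrier_vec n" "w \<in> carrier_vec n"
  shows "(P *\<^sub>v v) \<bullet>c w = (\<Sum>i<n. \<Sum>j<n. P $$ (i, j) * v $ j * cnj (w $ i))"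
  using assms by (auto simp: scalar_prod_def atLeast0LessThan sum_distrib_right intro!: sum.cong)

text \<open>The quadratic form at \<open>v\<close> is the squared norm of the combination of the
  vectors \<open>x j\<close> with coefficients \<open>v $ j\<close>. The order of \<open>i\<close>
  and \<open>j\<close> follows from \<open>cinner\<close> being linear in its first
  argument.\<close>

lemma psd_mat_Gram:
  "psd_mat n (Matrix.mat n n (\<lambda>(i, j). cinner (x j) (x i)))" (is "psd_mat n ?P")
  unfolding psd_mat_def
proof (intro conjI ballI)
  show "mat_adjoint ?P = ?P"
  proof (rule eq_matI)
    fix i j assume "i < dim_row ?P" "j < dim_col ?P"
    then show "mat_adjoint ?P $$ (i, j) = ?P $$ (i, j)"
      by (subst index_mat_adjoint[of _ n n]) (auto simp: cinner_commute[of "x j"])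
  qed (simp_all add: mat_adjoint_def)
  fix v :: "complex vec" assume v: "v \<in> carrier_vec n"
  have "(?P *\<^sub>v v) \<bullet>c v = cinner (\<Sum>j<n. cscale (v $ j) (x j)) (\<Sum>j<n. cscale (v $ j) (x j))"
    unfolding sesquilinear_form_sum[OF mat_carrier v v] cinner_sum_left cinner_sum_right
    by (auto simp: cinner_cscale_left cinner_cscale_right mult_ac intro!: sum.cong)
  then show "0 \<le> Re ((?P *\<^sub>v v) \<bullet>c v)"
    by (simp add: cinner_self)
qed simp

text \<open>The matrix in question is the Gram matrix of the images under \<open>T\<close> of the
  vacuum basis vectors.\<close>

lemma psd_vacuum_exp:
  assumes "adjoint_pair T T'" shows "psd_mat n (vacuum_exp n (T' o\<^sub>L T))"
proof -
  have "vacuum_exp n (T' o\<^sub>L T) = Matrix.mat n n (\<lambda>(i, j).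
      cinner (blinfun_apply T (basis_ell2 j)) (blinfun_apply T (basis_ell2 i)))"
    unfolding vacuum_exp_def
    by (rule cong_mat) (auto simp: adjoint_pair_coord[OF adjoint_pair_sym[OF assms]])
  then show ?thesis by (simp add: psd_mat_Gram)
qed

lemma mat_prob_space_op_cstar:
  assumes "n \<ge> 1"
  shows "mat_prob_space op_cstar n (\<lambda>b. op_code (mat_op n b)) (\<lambda>x. vacuum_exp n (op_decode x))"
proof (intro mat_prob_space.intro[OF cstar_algebra_op_cstar] mat_prob_space_axioms.intro)
  have n: "n > 0" using assms by simp
  note [simp] = mat_op_adjointable
  show "(\<lambda>b. op_code (mat_op n b)) \<in> Ring.ring_hom (ring_mat TYPE(complex) n ()) op_cstar"
    by (rule ring_hom_memI) (simp_all add: ring_mat_simps mat_op_mult mat_op_add mat_op_one n)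
  show "inj_on (\<lambda>b. op_code (mat_op n b)) (carrier_mat n n)"
    by (rule inj_on_inverseI[where g = "\<lambda>x. vacuum_exp n (op_decode x)"]) (simp add: vacuum_exp_mat_op n)
  fix b :: "complex mat" and c assume b: "b \<in> carrier_mat n n"
  show "op_code (mat_op n (c \<cdot>\<^sub>m b)) = c \<odot>\<^bsub>op_cstar\<^esub> op_code (mat_op n b)"
    using b n by (simp add: mat_op_smult)
  show "op_code (mat_op n (mat_adjoint b)) = star op_cstar (op_code (mat_op n b))"
    using b by (simp add: adj_eq[OF adjoint_pair_mat_op])
next
  have n: "n > 0" using assms by simp
  fix a and b b' :: "complex mat"
  assume a: "a \<in> carrier op_cstar" and b: "b \<in> carrier_mat n n" "b' \<in> carrier_mat n n"
  then show "vacuum_exp n (op_decode (op_code (mat_op n b) \<otimes>\<^bsub>op_cstar\<^esub> a \<otimes>\<^bsub>op_cstar\<^esub> op_code (mat_op n b')))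
      = b * vacuum_exp n (op_decode a) * b'"
    using n by (auto elim!: op_cstar_carrierE simp: mat_op_adjointable vacuum_exp_bimodule)
next
  show "vacuum_exp n (op_decode \<one>\<^bsub>op_cstar\<^esub>) = 1\<^sub>m n"
    using assms vacuum_exp_mat_op[of "1\<^sub>m n" n] by (simp add: mat_op_one)
next
  fix a assume "a \<in> carrier op_cstar"
  then show "psd_mat n (vacuum_exp n (op_decode (star op_cstar a \<otimes>\<^bsub>op_cstar\<^esub> a)))"
    by (auto elim!: op_cstar_carrierE simp: psd_vacuum_exp[OF adjoint_pair_adj])
qed (use assms in \<open>auto elim!: op_cstar_carrierE intro!: eq_matI simp: blinfun.add_left\<close>)

section \<open>Positivity of P \<otimes> 1\<close>

lemma sum_blocks: "(\<Sum>m<k * n. f m) = (\<Sum>p<k. \<Sum>i<n. f (p * n + i))" for k n :: nat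
proof -
  have "(\<Sum>m<k * n. f m) = (\<Sum>p<k. sum f {p * n..<p * n + n})"
    by (rule sum.nat_group[symmetric])
  also have "\<dots> = (\<Sum>p<k. \<Sum>i<n. f (p * n + i))"
  proof (rule sum.cong[OF refl])
    fix p show "sum f {p * n..<p * n + n} = (\<Sum>i<n. f (p * n + i))"
      using sum.shift_bounds_nat_ivl[of f 0 "p * n" n] by (simp add: add.commute atLeast0LessThan)
  qed
  finally show ?thesis .
qed

text \<open>Single terms may be negative. The partial sums up to multiples of \<open>n\<close> are
  nonnegative and form a subsequence with the same limit.\<close>

lemma infsum_blocks_nonneg:
  fixes f :: "nat \<Rightarrow> real"
  assumes "f summable_on UNIV" "\<And>k. 0 \<le> (\<Sum>i<n. f (k * n + i))" "n > 0"
  shows "0 \<le> infsum f UNIV"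
proof (rule LIMSEQ_le_const)
  have "(\<lambda>N. sum f {..<N}) \<longlonglongrightarrow> infsum f UNIV"
    using has_sum_imp_sums[OF has_sum_infsum[OF assms(1)]] by (simp add: sums_def)
  then show "(\<lambda>k. sum f {..<k * n}) \<longlonglongrightarrow> infsum f UNIV"
    by (rule filterlim_compose) (use assms(3) in \<open>auto intro!: filterlim_subseq strict_monoI\<close>)
  have "0 \<le> sum f {..<k * n}" for k
    unfolding sum_blocks using assms(2) by (simp add: sum_nonneg)
  then show "\<exists>N. \<forall>k\<ge>N. 0 \<le> sum f {..<k * n}" by blast
qed

text \<open>Every block of \<open>x\<close> contributes one value of the quadratic form of
  \<open>P\<close>.\<close>

lemma inner_mat_op_psd:
  assumes "psd_mat n P" "n > 0"
  shows "0 \<le> inner (blinfun_apply (mat_op n P) x) x"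
  unfolding inner_ell2_def
proof (rule infsum_blocks_nonneg[OF summable_on_inner_coord _ assms(2)])
  fix k
  let ?v = "Matrix.vec n (\<lambda>i. coord x (k * n + i))"
  have P: "P \<in> carrier_mat n n" and pos: "0 \<le> Re ((P *\<^sub>v ?v) \<bullet>c ?v)"
    using assms by (auto simp: psd_mat_def)
  have "(P *\<^sub>v ?v) \<bullet>c ?v = (\<Sum>i<n. coord (blinfun_apply (mat_op n P) x) (k * n + i) * cnj (coord x (k * n + i)))"
    unfolding sesquilinear_form_sum[OF P vec_carrier vec_carrier] coord_mat_op[OF assms(2)]
    by (intro sum.cong refl) (simp add: sum_distrib_right)
  then have "Re ((P *\<^sub>v ?v) \<bullet>c ?v)
      = (\<Sum>i<n. inner (coord (blinfun_apply (mat_op n P) x) (k * n + i)) (coord x (k * n + i)))"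
    by (simp add: inner_complex_def)
  then show "0 \<le> (\<Sum>i<n. inner (coord (blinfun_apply (mat_op n P) x) (k * n + i)) (coord x (k * n + i)))"
    using pos by simp
qed

section \<open>Invertibility of dissipative operators\<close>

text \<open>Instead of summing the Neumann series, \<open>R z\<close> is the fixed point of the
  contraction that sends \<open>y\<close> to \<open>z + K y\<close>.\<close>

lemma contraction_inverse:
  fixes K :: "'a::banach \<Rightarrow>\<^sub>L 'a"
  assumes "norm K < 1"
  obtains R where "(id_blinfun - K) o\<^sub>L R = id_blinfun" "R o\<^sub>L (id_blinfun - K) = id_blinfun"
proof -
  have ex1: "\<exists>!y. z + blinfun_apply K y = y" for z
  proof (rule banach_fix_type[OF norm_ge_zero assms], intro allI)
    fix x y show "dist (z + blinfun_apply K x) (z + blinfun_apply K y) \<le> norm K * dist x y"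
      using norm_blinfun[of K "x - y"] by (simp add: dist_norm blinfun.diff_right)
  qed
  define r where "r z = (THE y. z + blinfun_apply K y = y)" for z
  have r: "z + blinfun_apply K (r z) = r z" for z
    unfolding r_def by (rule theI'[OF ex1])
  have r_eq: "r z = y" if "z + blinfun_apply K y = y" for z y
    using ex1[of z] r[of z] that by blast
  have "bounded_linear r"
  proof (rule bounded_linear_intro)
    fix x y c
    show "r (x + y) = r x + r y"
      by (rule r_eq) (metis (no_types, lifting) add.assoc add.left_commute blinfun.add_right r)
    show "r (c *\<^sub>R x) = c *\<^sub>R r x"
      by (rule r_eq) (metis blinfun.scaleR_right r scaleR_add_right)
    have "norm (r x) \<le> norm x + norm K * norm (r x)"
      using norm_triangle_ineq[of x "blinfun_apply K (r x)"] norm_blinfun[of K "r x"]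
      unfolding r by linarith
    then show "norm (r x) \<le> norm x * (1 / (1 - norm K))"
      using assms by (simp add: field_simps)
  qed
  then have R: "blinfun_apply (Blinfun r) = r" by (rule bounded_linear_Blinfun_apply)
  show thesis
  proof (rule that)
    show "(id_blinfun - K) o\<^sub>L Blinfun r = id_blinfun"
    proof (rule blinfun_eqI)
      fix z show "blinfun_apply ((id_blinfun - K) o\<^sub>L Blinfun r) z = blinfun_apply id_blinfun z"
        using r[of z] by (simp add: R blinfun.diff_left algebra_simps)
    qed
    show "Blinfun r o\<^sub>L (id_blinfun - K) = id_blinfun"
      by (rule blinfun_eqI) (simp add: R blinfun.diff_left r_eq)
  qed
qed

text \<open>The adjoint of the inverse is the inverse of the adjoint: the contraction
  \<open>K'\<close> has the same norm, and <R x, (1 - K') R' y> = <(1 - K) R x, R' y>.\<close>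

lemma contraction_inverse_adjointable:
  assumes K: "adjoint_pair K K'" "norm K < 1"
  obtains R where "R \<in> adjointable" "(id_blinfun - K) o\<^sub>L R = id_blinfun" "R o\<^sub>L (id_blinfun - K) = id_blinfun"
proof -
  obtain R where R: "(id_blinfun - K) o\<^sub>L R = id_blinfun" "R o\<^sub>L (id_blinfun - K) = id_blinfun"
    using contraction_inverse[OF K(2)] by blast
  have "norm K' < 1" using K by (simp add: norm_adjoint)
  from contraction_inverse[OF this] obtain R' where R': "(id_blinfun - K') o\<^sub>L R' = id_blinfun"
    by blast
  have pair: "adjoint_pair (id_blinfun - K) (id_blinfun - K')"
    by (intro adjoint_pair_diff adjoint_pair_id K)
  have "adjoint_pair R R'"
    unfolding adjoint_pair_def
  proof (intro allI)
    fix x y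
    have "cinner (blinfun_apply R x) (blinfun_apply ((id_blinfun - K') o\<^sub>L R') y)
        = cinner (blinfun_apply ((id_blinfun - K) o\<^sub>L R) x) (blinfun_apply R' y)"
      by (simp add: adjoint_pairD[OF pair])
    then show "cinner (blinfun_apply R x) y = cinner x (blinfun_apply R' y)"
      by (simp add: R R')
  qed
  then show thesis using that R adjointableI by blast
qed

text \<open>If the imaginary part of \<open>T\<close> is at least \<open>\<epsilon>\<close>, then \<open>1 + \<i> \<delta> T\<close> is a strict contraction for
  small \<open>\<delta> > 0\<close>, so that \<open>\<i> \<delta> T\<close> is invertible by the Neumann argument.\<close>

lemma dissipative_inverse:
  assumes T: "adjoint_pair T T'" and "\<epsilon> > 0"
    and diss: "\<And>x. inner (cscale \<i> (blinfun_apply T x)) x \<le> - \<epsilon> * (norm x)\<^sup>2"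
  obtains R where "R \<in> adjointable" "T o\<^sub>L R = id_blinfun" "R o\<^sub>L T = id_blinfun"
proof -
  \<comment> \<open>The factor 1 - 2 \<delta> \<epsilon> + \<delta>^2 M is minimal at \<delta> =
    \<epsilon> / M, with value 1 - \<epsilon>^2 / M. Including \<epsilon>^2 in \<open>M\<close>
    keeps \<open>M\<close> positive and turns this value into ||T||^2 / M < 1.\<close>
  define M where "M = (norm T)\<^sup>2 + \<epsilon>\<^sup>2"
  define \<delta> where "\<delta> = \<epsilon> / M"
  have M: "M > 0" using \<open>\<epsilon> > 0\<close> by (simp add: M_def add_nonneg_pos)
  have \<delta>: "\<delta> > 0" using M \<open>\<epsilon> > 0\<close> by (simp add: \<delta>_def)
  define c where "c = - \<i> * complex_of_real \<delta>"
  define K where "K = id_blinfun - opscale c T"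
  have K_apply: "blinfun_apply K x = x + \<delta> *\<^sub>R cscale \<i> (blinfun_apply T x)" for x
    by (rule ell2_eqI) (simp add: K_def c_def blinfun.diff_left scaleR_conv_of_real)
  have "norm K \<le> sqrt ((norm T)\<^sup>2 / M)"
  proof (rule norm_blinfun_bound)
    fix x
    have "(norm (blinfun_apply K x))\<^sup>2
        = (norm x)\<^sup>2 + 2 * \<delta> * inner (cscale \<i> (blinfun_apply T x)) x + \<delta>\<^sup>2 * (norm (blinfun_apply T x))\<^sup>2"
    proof -
      have "(norm (x + v))\<^sup>2 = (norm x)\<^sup>2 + 2 * inner v x + (norm v)\<^sup>2" for v
        by (simp add: power2_norm_eq_inner inner_add_left inner_add_right inner_commute)
      then show ?thesis
        by (simp add: K_apply norm_cscale power_mult_distrib)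
    qed
    also have "\<dots> \<le> (norm x)\<^sup>2 + 2 * \<delta> * (- \<epsilon> * (norm x)\<^sup>2) + \<delta>\<^sup>2 * (norm T * norm x)\<^sup>2"
      using \<delta> by (intro add_mono mult_left_mono diss power_mono norm_blinfun order_refl) simp_all
    also have "\<dots> = (1 - 2 * \<delta> * \<epsilon> + \<delta>\<^sup>2 * (norm T)\<^sup>2) * (norm x)\<^sup>2"
      by (simp add: algebra_simps power_mult_distrib)
    also have "\<dots> \<le> (1 - 2 * \<delta> * \<epsilon> + \<delta>\<^sup>2 * M) * (norm x)\<^sup>2"
      by (intro mult_right_mono add_left_mono mult_left_mono) (simp_all add: M_def)
    also have "1 - 2 * \<delta> * \<epsilon> + \<delta>\<^sup>2 * M = (norm T)\<^sup>2 / M"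
    proof -
      have "1 - 2 * \<delta> * \<epsilon> + \<delta>\<^sup>2 * M = 1 - \<epsilon>\<^sup>2 / M"
        using M by (simp add: \<delta>_def power2_eq_square)
      also have "\<dots> = (M - \<epsilon>\<^sup>2) / M"
        using M by (simp add: diff_divide_distrib)
      finally show ?thesis by (simp add: M_def)
    qed
    finally have "sqrt ((norm (blinfun_apply K x))\<^sup>2) \<le> sqrt ((norm T)\<^sup>2 / M * (norm x)\<^sup>2)"
      by (rule real_sqrt_le_mono)
    then show "norm (blinfun_apply K x) \<le> sqrt ((norm T)\<^sup>2 / M) * norm x"
      by (simp only: real_sqrt_mult real_sqrt_abs abs_norm_cancel)
  qed (use M in simp)
  also have "\<dots> < 1"
    using M \<open>\<epsilon> > 0\<close> by (simp add: M_def)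
  finally have "norm K < 1" .
  moreover have pairK: "adjoint_pair K (id_blinfun - opscale (cnj c) T')"
    unfolding K_def by (intro adjoint_pair_diff adjoint_pair_id adjoint_pair_opscale T)
  ultimately obtain R where R: "R \<in> adjointable"
      "(id_blinfun - K) o\<^sub>L R = id_blinfun" "R o\<^sub>L (id_blinfun - K) = id_blinfun"
    using contraction_inverse_adjointable by blast
  have idK: "id_blinfun - K = opscale c T" by (simp add: K_def)
  \<comment> \<open>\<open>R\<close> inverts \<open>c T\<close>, so \<open>c R\<close> inverts
    \<open>T\<close>; moving the scalar past an operator uses complex linearity.\<close>
  have 1: "cscale c (blinfun_apply T (blinfun_apply R x)) = x" for x
    using arg_cong[OF R(2), of "\<lambda>F. blinfun_apply F x"] by (simp add: idK)
  have 2: "cscale c (blinfun_apply R (blinfun_apply T x)) = x" for x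
    using arg_cong[OF R(3), of "\<lambda>F. blinfun_apply F x"]
    by (simp add: idK adjoint_pair_cscale[OF adjoint_pair_adj[OF R(1)]])
  show thesis
  proof (rule that)
    show "opscale c R \<in> adjointable" using R by simp
    show "T o\<^sub>L opscale c R = id_blinfun"
      by (rule blinfun_eqI) (simp add: adjoint_pair_cscale[OF T] 1)
    show "opscale c R o\<^sub>L T = id_blinfun"
      by (rule blinfun_eqI) (simp add: 2)
  qed
qed

section \<open>Imaginary parts of quadratic forms\<close>

lemma inner_imaginary: "inner (cscale \<i> x) y = - Im (cinner x y)"
proof -
  have "inner (cscale \<i> x) y = Re (cinner (cscale \<i> x) y)" by (simp add: cinner_def)
  then show ?thesis by (simp add: cinner_cscale_left)
qed

lemma Im_cinner_self_adjoint:
  assumes "adjoint_pair S S" shows "Im (cinner (blinfun_apply S x) x) = 0"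
proof -
  have "cinner (blinfun_apply S x) x = cnj (cinner (blinfun_apply S x) x)"
    using adjoint_pairD[OF assms, of x x] cinner_commute[of x "blinfun_apply S x"] by simp
  then show ?thesis by (metis Reals_cnj_iff complex_is_Real_iff)
qed

text \<open>Positivity of \<open>im_mat b\<close> minus \<epsilon> passes from matrices to the
  operators P \<otimes> 1, and the form of \<open>im_mat b\<close> is the imaginary part of the form
  of \<open>b\<close>.\<close>

lemma Im_cinner_upper_half:
  assumes b: "b \<in> carrier_mat n n" and "n > 0"
    and psd: "psd_mat n (im_mat b - complex_of_real \<epsilon> \<cdot>\<^sub>m 1\<^sub>m n)"
  shows "\<epsilon> * (norm x)\<^sup>2 \<le> Im (cinner (blinfun_apply (mat_op n b) x) x)"
proof -
  define z where "z = cinner (blinfun_apply (mat_op n b) x) x"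
  have "cinner (blinfun_apply (mat_op n (mat_adjoint b)) x) x = cnj z"
    unfolding z_def adjoint_pairD[OF adjoint_pair_mat_op[OF b]] by (rule cinner_commute)
  moreover have "mat_op n (im_mat b - complex_of_real \<epsilon> \<cdot>\<^sub>m 1\<^sub>m n)
      = opscale (1 / (2 * \<i>)) (mat_op n b - mat_op n (mat_adjoint b)) - opscale (complex_of_real \<epsilon>) id_blinfun"
  proof -
    have "im_mat b \<in> carrier_mat n n" using b by (simp add: im_mat_def minus_carrier_mat)
    then show ?thesis
      using b \<open>n > 0\<close> by (simp add: mat_op_diff mat_op_smult mat_op_one im_mat_def minus_carrier_mat)
  qed
  ultimately have "cinner (blinfun_apply (mat_op n (im_mat b - complex_of_real \<epsilon> \<cdot>\<^sub>m 1\<^sub>m n)) x) x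
      = (z - cnj z) / (2 * \<i>) - complex_of_real \<epsilon> * cinner x x"
    by (simp add: blinfun.diff_left cinner_diff_left cinner_cscale_left z_def)
  then have "inner (blinfun_apply (mat_op n (im_mat b - complex_of_real \<epsilon> \<cdot>\<^sub>m 1\<^sub>m n)) x) x = Im z - \<epsilon> * (norm x)\<^sup>2"
    by (simp add: cinner_def complex_eq_iff complex_diff_cnj cinner_self[unfolded cinner_def] power2_norm_eq_inner)
  then show ?thesis
    using inner_mat_op_psd[OF psd \<open>n > 0\<close>, of x] by (simp add: z_def)
qed

section \<open>The semicircular element\<close>

definition semicircular_op :: "nat \<Rightarrow> complex mat \<Rightarrow> complex mat \<Rightarrow> operator" where
  "semicircular_op n D V
    = mat_op n D + ((mat_op n V o\<^sub>L coshift_op n) + (shift_op n o\<^sub>L mat_op n (mat_adjoint V)))"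

definition conj_map :: "complex mat \<Rightarrow> complex mat \<Rightarrow> complex mat" where
  "conj_map V b = V * b * mat_adjoint V"

lemma conj_map_carrier: "V \<in> carrier_mat n n \<Longrightarrow> b \<in> carrier_mat n n \<Longrightarrow> conj_map V b \<in> carrier_mat n n"
  unfolding conj_map_def by (intro mult_carrier_mat mat_adjoint_carrier)

lemma self_adjoint_semicircular_op:
  assumes "D \<in> carrier_mat n n" "V \<in> carrier_mat n n" "mat_adjoint D = D"
  shows "adjoint_pair (semicircular_op n D V) (semicircular_op n D V)"
proof -
  have V: "adjoint_pair (mat_op n V) (mat_op n (mat_adjoint V))"
    by (rule adjoint_pair_mat_op[OF assms(2)])
  have "adjoint_pair (semicircular_op n D V)
     (mat_op n (mat_adjoint D) + ((shift_op n o\<^sub>L mat_op n (mat_adjoint V)) + (mat_op n V o\<^sub>L coshift_op n)))"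
    unfolding semicircular_op_def
    by (intro adjoint_pair_add adjoint_pair_compose adjoint_pair_mat_op[OF assms(1)] V
        adjoint_pair_sym[OF V] adjoint_pair_shift_op adjoint_pair_sym[OF adjoint_pair_shift_op])
  then show ?thesis
    by (simp add: semicircular_op_def assms add.commute)
qed

text \<open>The self-adjoint \<open>semicircular_op\<close> adds nothing to the imaginary part of
  the form, so the lower bound \<epsilon> of \<open>b\<close> survives the subtraction.\<close>

lemma resolvent_semicircular_op:
  assumes "D \<in> carrier_mat n n" "V \<in> carrier_mat n n" "mat_adjoint D = D" "b \<in> upper_half n" "n > 0"
  obtains R where "R \<in> adjointable" "(mat_op n b - semicircular_op n D V) o\<^sub>L R = id_blinfun"
    "R o\<^sub>L (mat_op n b - semicircular_op n D V) = id_blinfun"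
proof -
  from assms(4) obtain \<epsilon> where b: "b \<in> carrier_mat n n" "\<epsilon> > 0"
      "psd_mat n (im_mat b - complex_of_real \<epsilon> \<cdot>\<^sub>m 1\<^sub>m n)"
    by (auto simp: upper_half_def)
  note s = self_adjoint_semicircular_op[OF assms(1-3)]
  have "adjoint_pair (mat_op n b - semicircular_op n D V) (mat_op n (mat_adjoint b) - semicircular_op n D V)"
    by (intro adjoint_pair_diff s adjoint_pair_mat_op b)
  moreover have "inner (cscale \<i> (blinfun_apply (mat_op n b - semicircular_op n D V) x)) x \<le> - \<epsilon> * (norm x)\<^sup>2" for x
    using Im_cinner_upper_half[OF b(1) assms(5) b(3), of x] Im_cinner_self_adjoint[OF s, of x]
    by (simp add: inner_imaginary blinfun.diff_left cinner_diff_left)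
  ultimately show thesis
    using dissipative_inverse[OF _ b(2)] that by blast
qed

text \<open>The coshift intertwines \<open>b - s\<close> with itself up to a term supported on the vacuum block, which
  makes the vacuum block of the resolvent a fixed point.\<close>

lemma vacuum_exp_resolvent:
  assumes D: "D \<in> carrier_mat n n" and V: "V \<in> carrier_mat n n" and b: "b \<in> carrier_mat n n" and n: "n > 0"
    and R: "R \<in> adjointable" "(mat_op n b - semicircular_op n D V) o\<^sub>L R = id_blinfun"
      "R o\<^sub>L (mat_op n b - semicircular_op n D V) = id_blinfun"
  defines "G \<equiv> vacuum_exp n R"
  shows "b * G = 1\<^sub>m n + (D + conj_map V G) * G"
proof (rule eq_matI)
  have G: "G \<in> carrier_mat n n" by (simp add: G_def)
  have V': "mat_adjoint V \<in> carrier_mat n n" using V by simp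
  define T where "T = mat_op n b - semicircular_op n D V"
  have coord_T: "coord (blinfun_apply T x) m = (\<Sum>l<n. (b $$ (m mod n, l) - D $$ (m mod n, l)) * coord x (m div n * n + l))
      - (\<Sum>l<n. V $$ (m mod n, l) * coord x (m div n * n + l + n))
      - (if n \<le> m then (\<Sum>l<n. mat_adjoint V $$ ((m - n) mod n, l) * coord x ((m - n) div n * n + l)) else 0)" for x m
    by (simp add: T_def semicircular_op_def blinfun.diff_left blinfun.add_left coord_mat_op n
        left_diff_distrib sum_subtractf)
  fix i j assume "i < dim_row (1\<^sub>m n + (D + conj_map V G) * G)" "j < dim_col (1\<^sub>m n + (D + conj_map V G) * G)"
  then have ij: "i < n" "j < n" using V G by (auto simp: conj_map_def)
  \<comment> \<open>Column \<open>j\<close> of the resolvent, with blocks y_0, y_1, ...; y_0 is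
    column \<open>j\<close> of \<open>G\<close>. Block 0 of \<open>T y = basis_ell2 j\<close> reads
    (b - D) y_0 - V y_1 = e_j, so the claim reduces to y_1 = G V^* y_0.\<close>
  define y where "y = blinfun_apply R (basis_ell2 j)"
  have Ty: "blinfun_apply T y = basis_ell2 j"
    using arg_cong[OF R(2), of "\<lambda>F. blinfun_apply F (basis_ell2 j)"] by (simp add: T_def y_def)
  have y: "coord y l = G $$ (l, j)" if "l < n" for l
    using that ij by (simp add: y_def G_def)
  define u where "u l = (mat_adjoint V * G) $$ (l, j)" for l
  have u: "u l = (\<Sum>k<n. mat_adjoint V $$ (l, k) * coord y k)" if "l < n" for l
    unfolding u_def index_mult_mat_sum[OF V' G that ij(2)] by (simp add: y)
  have "blinfun_apply T (blinfun_apply (coshift_op n) y) = (\<Sum>l<n. cscale (u l) (basis_ell2 l))"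
  proof (rule ell2_eqI)
    fix m
    have div: "(m + n) div n * n = m div n * n + n" "(m + n) mod n = m mod n"
      using n by simp_all
    \<comment> \<open>\<open>basis_ell2 j\<close> lies in block 0, so block k + 1 of
      \<open>T y\<close> vanishes: (b - D) y_(k+1) - V y_(k+2) = V^* y_k. The coshifted vector has
      the same left side, and for k > 0 its own lower term cancels the right side; only V^* y_0 in
      block 0 remains.\<close>
    have "coord (blinfun_apply T y) (m + n) = 0"
      using ij by (simp add: Ty coord_basis_ell2)
    then have eq: "(\<Sum>l<n. (b $$ (m mod n, l) - D $$ (m mod n, l)) * coord y (m div n * n + l + n))
      - (\<Sum>l<n. V $$ (m mod n, l) * coord y (m div n * n + l + n + n))
      = (\<Sum>l<n. mat_adjoint V $$ (m mod n, l) * coord y (m div n * n + l))"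
      unfolding coord_T div by (simp add: add_ac)
    have "coord (blinfun_apply T (blinfun_apply (coshift_op n) y)) m
        = (\<Sum>l<n. mat_adjoint V $$ (m mod n, l) * coord y (m div n * n + l))
          - (if n \<le> m then (\<Sum>l<n. mat_adjoint V $$ ((m - n) mod n, l) * coord y ((m - n) div n * n + l + n)) else 0)"
      unfolding coord_T coord_coshift_op eq ..
    also have "\<dots> = (if m < n then u m else 0)"
    proof (cases "m < n")
      case False
      then have 1: "(m - n) div n * n + n = m div n * n" and 2: "(m - n) mod n = m mod n"
        using n by (simp_all add: le_div_geq le_mod_geq)
      have "(m - n) div n * n + l + n = m div n * n + l" for l
        using 1 by linarith
      with 2 False show ?thesis by (simp only: not_less if_True if_False diff_self) simp
    qed (simp add: u)
    also have "\<dots> = coord (\<Sum>l<n. cscale (u l) (basis_ell2 l)) m"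
      by (simp add: coord_sum coord_basis_ell2 if_distrib[of "\<lambda>x. _ * x"] cong: if_cong)
    finally show "coord (blinfun_apply T (blinfun_apply (coshift_op n) y)) m
        = coord (\<Sum>l<n. cscale (u l) (basis_ell2 l)) m" .
  qed
  \<comment> \<open>Applying \<open>R\<close> gives the coshift of \<open>y\<close> as
    \<open>R\<close> of a vacuum vector; its block 0 is y_1 on one side and G V^* y_0 on the
    other.\<close>
  then have "blinfun_apply (R o\<^sub>L T) (blinfun_apply (coshift_op n) y)
      = (\<Sum>l<n. cscale (u l) (blinfun_apply R (basis_ell2 l)))"
    by (simp add: blinfun.sum_right adjoint_pair_cscale[OF adjoint_pair_adj[OF R(1)]])
  then have "blinfun_apply (coshift_op n) y = (\<Sum>l<n. cscale (u l) (blinfun_apply R (basis_ell2 l)))"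
    by (simp add: T_def R(3))
  then have "coord y (k + n) = (\<Sum>l<n. u l * coord (blinfun_apply R (basis_ell2 l)) k)" for k
    by (metis (mono_tags, lifting) coord_coshift_op coord_cscale coord_sum sum.cong)
  then have yn: "coord y (k + n) = (G * (mat_adjoint V * G)) $$ (k, j)" if "k < n" for k
    using that ij unfolding index_mult_mat_sum[OF G mult_carrier_mat[OF V' G] that ij(2)]
    by (simp add: u_def G_def mult.commute)
  have "(if i = j then 1 else 0) = coord (blinfun_apply T y) i"
    by (simp add: Ty coord_basis_ell2)
  also have "\<dots> = (\<Sum>l<n. b $$ (i, l) * G $$ (l, j)) - (\<Sum>l<n. D $$ (i, l) * G $$ (l, j))
      - (\<Sum>l<n. V $$ (i, l) * (G * (mat_adjoint V * G)) $$ (l, j))"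
    using ij by (simp add: coord_T y yn left_diff_distrib sum_subtractf del: index_mult_mat)
  also have "\<dots> = (b * G) $$ (i, j) - (D * G) $$ (i, j) - (V * (G * (mat_adjoint V * G))) $$ (i, j)"
    using ij G V D b mult_carrier_mat[OF G mult_carrier_mat[OF V' G]]
    by (simp add: index_mult_mat_sum[of _ n n _ n] del: index_mult_mat)
  also have "V * (G * (mat_adjoint V * G)) = conj_map V G * G"
    using G V V' by (simp add: conj_map_def assoc_mult_mat[of _ n n _ n _ n])
  moreover have "(D + conj_map V G) * G = D * G + conj_map V G * G"
    by (rule add_mult_distrib_mat[OF D conj_map_carrier[OF V G] G])
  ultimately show "(b * G) $$ (i, j) = (1\<^sub>m n + (D + conj_map V G) * G) $$ (i, j)"
    using ij G conj_map_carrier[OF V G] D by (simp del: index_mult_mat(1))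
qed (use V b in \<open>auto simp: conj_map_def G_def\<close>)

section \<open>The variance\<close>

lemma linear_conj_map:
  assumes V: "V \<in> carrier_mat n n" shows "linear_mat_map n (conj_map V)"
  unfolding linear_mat_map_def conj_map_def
proof (intro conjI ballI allI)
  note V' = mat_adjoint_carrier[OF V]
  fix b c :: "complex mat" and z
  assume b: "b \<in> carrier_mat n n"
  show "V * b * mat_adjoint V \<in> carrier_mat n n" by (rule mult_carrier_mat[OF mult_carrier_mat[OF V b] V'])
  show "V * (z \<cdot>\<^sub>m b) * mat_adjoint V = z \<cdot>\<^sub>m (V * b * mat_adjoint V)"
    using V b V' by (simp add: mult_smult_distrib[OF V b] mult_smult_assoc_mat[of _ n n _ n])
  assume c: "c \<in> carrier_mat n n"
  show "V * (b + c) * mat_adjoint V = V * b * mat_adjoint V + V * c * mat_adjoint V"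
    using V b c V' by (simp add: mult_add_distrib_mat[OF V b c] add_mult_distrib_mat[of _ n n _ _ n])
qed

lemma index_conj:
  assumes W: "W \<in> carrier_mat n n" and X: "X \<in> carrier_mat n n" and ij: "i < n" "j < n"
  shows "(W * X * mat_adjoint W) $$ (i, j) = (\<Sum>c<n. \<Sum>d<n. W $$ (i, c) * X $$ (c, d) * cnj (W $$ (j, d)))"
proof -
  have "(W * X * mat_adjoint W) $$ (i, j) = (\<Sum>d<n. (\<Sum>c<n. W $$ (i, c) * X $$ (c, d)) * cnj (W $$ (j, d)))"
    unfolding index_mult_mat_sum[OF mult_carrier_mat[OF W X] mat_adjoint_carrier[OF W] ij]
    using ij by (intro sum.cong refl) (simp add: index_mult_mat_sum[OF W X] index_mat_adjoint[OF W] del: index_mult_mat)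
  then show ?thesis by (subst sum.swap) (simp add: sum_distrib_right)
qed

text \<open>The quadratic form of W P W^* at v is that of P at W^* v.\<close>

lemma psd_mat_conj:
  assumes P: "psd_mat n P" and W: "W \<in> carrier_mat n n"
  shows "psd_mat n (W * P * mat_adjoint W)"
  unfolding psd_mat_def
proof (intro conjI ballI)
  have Pc: "P \<in> carrier_mat n n" and Ph: "mat_adjoint P = P" using P by (auto simp: psd_mat_def)
  note W' = mat_adjoint_carrier[OF W]
  show WPW: "W * P * mat_adjoint W \<in> carrier_mat n n" by (rule mult_carrier_mat[OF mult_carrier_mat[OF W Pc] W'])
  show "mat_adjoint (W * P * mat_adjoint W) = W * P * mat_adjoint W"
  proof (rule eq_matI)
    fix i j assume "i < dim_row (W * P * mat_adjoint W)" "j < dim_col (W * P * mat_adjoint W)"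
    then have ij: "i < n" "j < n" using WPW by auto
    have Pji: "cnj (P $$ (c, d)) = P $$ (d, c)" if "c < n" "d < n" for c d
      using index_mat_adjoint[OF Pc that(2,1)] by (simp add: Ph)
    have "mat_adjoint (W * P * mat_adjoint W) $$ (i, j)
        = (\<Sum>c<n. \<Sum>d<n. W $$ (i, d) * P $$ (d, c) * cnj (W $$ (j, c)))"
      unfolding index_mat_adjoint[OF WPW ij] index_conj[OF W Pc ij(2,1)] cnj_sum
      by (intro sum.cong refl) (simp add: Pji)
    also have "\<dots> = (W * P * mat_adjoint W) $$ (i, j)"
      unfolding index_conj[OF W Pc ij] by (rule sum.swap)
    finally show "mat_adjoint (W * P * mat_adjoint W) $$ (i, j) = (W * P * mat_adjoint W) $$ (i, j)" .
  qed (use carrier_matD[OF WPW] carrier_matD[OF mat_adjoint_carrier[OF WPW]] in simp_all)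
  fix v :: "complex vec" assume v: "v \<in> carrier_vec n"
  define u where "u = mat_adjoint W *\<^sub>v v"
  have u: "u \<in> carrier_vec n" unfolding u_def using W' v by simp
  have Pu: "P *\<^sub>v u \<in> carrier_vec n" using Pc u by simp
  have "(W *\<^sub>v (P *\<^sub>v u)) \<bullet>c v = (P *\<^sub>v u) \<bullet>c u"
  proof -
    have uj: "u $ j = (\<Sum>i<n. cnj (W $$ (i, j)) * v $ i)" if "j < n" for j
      using that v W W' carrier_matD[OF W']
      by (auto simp: u_def scalar_prod_def atLeast0LessThan index_mat_adjoint[OF W] intro!: sum.cong)
    have "(P *\<^sub>v u) \<bullet>c u = (\<Sum>j<n. (P *\<^sub>v u) $ j * cnj (u $ j))"
      using carrier_vecD[OF u] by (simp add: scalar_prod_def atLeast0LessThan)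
    also have "\<dots> = (\<Sum>j<n. (P *\<^sub>v u) $ j * cnj (\<Sum>i<n. cnj (W $$ (i, j)) * v $ i))"
      by (intro sum.cong refl) (simp add: uj)
    also have "\<dots> = (\<Sum>i<n. \<Sum>j<n. W $$ (i, j) * (P *\<^sub>v u) $ j * cnj (v $ i))"
      unfolding cnj_sum sum_distrib_left by (subst sum.swap) (simp add: mult_ac)
    finally show ?thesis by (simp add: sesquilinear_form_sum[OF W Pu v])
  qed
  moreover have "W * P * mat_adjoint W *\<^sub>v v = W *\<^sub>v (P *\<^sub>v u)"
    unfolding u_def
    by (simp only: assoc_mult_mat_vec[OF mult_carrier_mat[OF W Pc] W' v] assoc_mult_mat_vec[OF W Pc u[unfolded u_def]])
  ultimately show "0 \<le> Re ((W * P * mat_adjoint W *\<^sub>v v) \<bullet>c v)"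
    using P u by (simp add: psd_mat_def)
qed

text \<open>The matrix 1_k \<otimes> V in the block convention of \<open>amplify\<close>. Amplifying
  a conjugation gives conjugation by this matrix, whence complete positivity.\<close>

definition block_diag :: "nat \<Rightarrow> nat \<Rightarrow> complex mat \<Rightarrow> complex mat" where
  "block_diag k n V = Matrix.mat (k * n) (k * n)
     (\<lambda>(m, c). if m div n = c div n then V $$ (m mod n, c mod n) else 0)"

lemma sum_block_diag:
  fixes q k n :: nat
  assumes "q < k"
  shows "(\<Sum>c<k * n. (if q = c div n then f (c mod n) else 0) * g c) = (\<Sum>a<n. f a * (g (q * n + a) :: complex))"
proof -
  have "(\<Sum>c<k * n. (if q = c div n then f (c mod n) else 0) * g c)
      = (\<Sum>p<k. if q = p then \<Sum>a<n. f a * g (p * n + a) else 0)"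
    unfolding sum_blocks by (intro sum.cong refl) auto
  also have "\<dots> = (\<Sum>a<n. f a * g (q * n + a))" using assms by simp
  finally show ?thesis .
qed

lemma amplify_conj_map:
  assumes V: "V \<in> carrier_mat n n" and P: "P \<in> carrier_mat (k * n) (k * n)"
  shows "amplify k n (conj_map V) P = block_diag k n V * P * mat_adjoint (block_diag k n V)"
proof (rule eq_matI)
  let ?W = "block_diag k n V"
  have W: "?W \<in> carrier_mat (k * n) (k * n)" by (simp add: block_diag_def)
  have WPW: "?W * P * mat_adjoint ?W \<in> carrier_mat (k * n) (k * n)"
    by (rule mult_carrier_mat[OF mult_carrier_mat[OF W P] mat_adjoint_carrier[OF W]])
  fix i j assume "i < dim_row (?W * P * mat_adjoint ?W)" "j < dim_col (?W * P * mat_adjoint ?W)"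
  then have ij: "i < k * n" "j < k * n" using WPW by auto
  then have n: "n > 0" by (cases n) auto
  have div: "i div n < k" "j div n < k" using ij by (simp_all add: less_mult_imp_div_less)
  have "(?W * P * mat_adjoint ?W) $$ (i, j)
      = (\<Sum>c<k * n. (if i div n = c div n then V $$ (i mod n, c mod n) else 0) *
          (\<Sum>d<k * n. (if j div n = d div n then cnj (V $$ (j mod n, d mod n)) else 0) * P $$ (c, d)))"
    unfolding index_conj[OF W P ij] sum_distrib_left
    by (intro sum.cong refl) (use ij in \<open>simp add: block_diag_def\<close>)
  also have "\<dots> = (\<Sum>a<n. V $$ (i mod n, a) *
      (\<Sum>b<n. cnj (V $$ (j mod n, b)) * P $$ (i div n * n + a, j div n * n + b)))"
    unfolding sum_block_diag[OF div(2), of n "\<lambda>b. cnj (V $$ (j mod n, b))"]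
    by (rule sum_block_diag[OF div(1)])
  also have "\<dots> = conj_map V (mat_block n P (i div n) (j div n)) $$ (i mod n, j mod n)"
  proof -
    have B: "mat_block n P (i div n) (j div n) \<in> carrier_mat n n" by (simp add: mat_block_def)
    show ?thesis
      unfolding conj_map_def index_conj[OF V B mod_less_divisor[OF n] mod_less_divisor[OF n]] sum_distrib_left
      by (intro sum.cong refl) (simp add: mat_block_def)
  qed
  finally show "amplify k n (conj_map V) P $$ (i, j) = (?W * P * mat_adjoint ?W) $$ (i, j)"
    using ij by (simp add: amplify_def)
qed (use P in \<open>auto simp: amplify_def block_diag_def mat_adjoint_def\<close>)

lemma completely_positive_conj_map:
  assumes "V \<in> carrier_mat n n" shows "completely_positive n (conj_map V)"
  unfolding completely_positive_def
proof (intro conjI allI impI linear_conj_map assms)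
  fix k P assume P: "psd_mat (k * n) P"
  then have "P \<in> carrier_mat (k * n) (k * n)" by (simp add: psd_mat_def)
  then show "psd_mat (k * n) (amplify k n (conj_map V) P)"
    by (simp add: amplify_conj_map assms psd_mat_conj[OF P] block_diag_def)
qed

lemma nilpotent_conj_map:
  assumes V: "V \<in> carrier_mat n n" and sq: "V * V = 0\<^sub>m n n"
  shows "nilpotent_mat_map n (conj_map V)"
  unfolding nilpotent_mat_map_def
proof (intro exI[of _ 2] conjI ballI)
  fix b :: "complex mat" assume b: "b \<in> carrier_mat n n"
  note V' = mat_adjoint_carrier[OF V]
  have bV: "b * mat_adjoint V \<in> carrier_mat n n" using b V' by simp
  have "V * (V * b * mat_adjoint V) = V * (V * (b * mat_adjoint V))"
    using V b V' by (simp add: assoc_mult_mat[of _ n n _ n _ n])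
  also have "\<dots> = V * V * (b * mat_adjoint V)"
    by (rule assoc_mult_mat[OF V V bV, symmetric])
  also have "\<dots> = 0\<^sub>m n n"
    unfolding sq by (rule left_mult_zero_mat[OF bV])
  finally show "(conj_map V ^^ 2) b = 0\<^sub>m n n"
    using V' by (simp add: numeral_2_eq_2 conj_map_def)
qed simp

section \<open>Matrix-valued semicircular elements with variance \<open>b \<mapsto> V b V\<^sup>*\<close>\<close>

text \<open>The ring inverse in \<open>op_cstar\<close> is the code of the operator resolvent, which
  turns \<open>op_cauchy\<close> into the vacuum block of
  \<open>vacuum_exp_resolvent\<close>.\<close>

lemma op_cauchy_semicircular:
  assumes "D \<in> carrier_mat n n" "V \<in> carrier_mat n n" "mat_adjoint D = D" "b \<in> upper_half n" "n > 0"
  defines "G \<equiv> op_cauchy op_cstar (\<lambda>b. op_code (mat_op n b)) (\<lambda>x. vacuum_exp n (op_decode x))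
    (op_code (semicircular_op n D V)) b"
  shows "G \<in> carrier_mat n n" "b * G = 1\<^sub>m n + (D + conj_map V G) * G"
proof -
  have b: "b \<in> carrier_mat n n" using assms(4) by (simp add: upper_half_def)
  obtain R where R: "R \<in> adjointable" "(mat_op n b - semicircular_op n D V) o\<^sub>L R = id_blinfun"
    "R o\<^sub>L (mat_op n b - semicircular_op n D V) = id_blinfun"
    using resolvent_semicircular_op[OF assms(1-5)] by blast
  have s: "semicircular_op n D V \<in> adjointable"
    using self_adjoint_semicircular_op[OF assms(1-3)] by (rule adjointableI)
  have "G = vacuum_exp n R"
    unfolding G_def op_cauchy_def
    by (simp add: op_cstar_minus mat_op_adjointable b s op_cstar_inv[OF _ R] R(1))
  then show "G \<in> carrier_mat n n" "b * G = 1\<^sub>m n + (D + conj_map V G) * G"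
    using vacuum_exp_resolvent[OF assms(1,2) b assms(5) R] by simp_all
qed

lemma is_semicircular_semicircular_op:
  assumes "D \<in> carrier_mat n n" "V \<in> carrier_mat n n" "mat_adjoint D = D" "n > 0"
  shows "is_semicircular n op_cstar (\<lambda>b. op_code (mat_op n b)) (\<lambda>x. vacuum_exp n (op_decode x))
    D (conj_map V) (op_code (semicircular_op n D V))"
proof -
  note s = self_adjoint_semicircular_op[OF assms(1-3)]
  show ?thesis
    unfolding is_semicircular_def has_R_transform_def
    using adjointableI[OF s] op_cauchy_semicircular(2)[OF assms(1-3) _ assms(4)]
    by (simp add: adj_eq[OF s] assms completely_positive_conj_map)
qed

section \<open>Cauchy transforms of finitely supported measures\<close>

definition monic_roots :: "real set \<Rightarrow> complex poly" where
  "monic_roots A = (\<Prod>u\<in>A. [:- complex_of_real u, 1:])"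

lemma poly_monic_roots: "poly (monic_roots A) z = (\<Prod>u\<in>A. z - complex_of_real u)"
  by (simp add: monic_roots_def poly_prod)

lemma degree_monic_roots: "degree (monic_roots A) = card A"
  unfolding monic_roots_def by (subst degree_prod_sum_eq) simp_all

lemma coeff_monic_roots: "finite A \<Longrightarrow> poly.coeff (monic_roots A) (card A) = 1"
  using lead_coeff_prod[of "\<lambda>u. [:- complex_of_real u, 1:]" A]
  by (simp add: degree_monic_roots monic_roots_def[symmetric])

lemma monic_roots_remove:
  "finite A \<Longrightarrow> u \<in> A \<Longrightarrow> monic_roots A = [:- complex_of_real u, 1:] * monic_roots (A - {u})"
  unfolding monic_roots_def by (rule prod.remove)

lemma poly_monic_roots_remove:
  "finite A \<Longrightarrow> u \<in> A
    \<Longrightarrow> poly (monic_roots A) z = (z - complex_of_real u) * poly (monic_roots (A - {u})) z"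
  by (simp add: monic_roots_remove left_diff_distrib)

lemma poly_monic_roots_eq_0_iff: "finite A \<Longrightarrow> poly (monic_roots A) z = 0 \<longleftrightarrow> z \<in> complex_of_real ` A"
  by (auto simp: poly_monic_roots)

locale finite_weights =
  fixes S :: "real set" and p :: "real \<Rightarrow> real"
  assumes finite_S: "finite S" and S_ne: "S \<noteq> {}"
    and p_pos: "\<And>t. t \<in> S \<Longrightarrow> p t > 0" and p_sum: "(\<Sum>t\<in>S. p t) = 1"
begin

definition G :: "complex \<Rightarrow> complex" where
  "G z = (\<Sum>t\<in>S. complex_of_real (p t) / (z - complex_of_real t))"

text \<open>Minus the derivative of \<open>G\<close> on the real line.\<close>

definition H :: "real \<Rightarrow> real" where
  "H x = (\<Sum>t\<in>S. p t / (x - t)\<^sup>2)"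

text \<open>The numerator of \<open>G\<close> over the common denominator
  \<open>monic_roots S\<close>.\<close>

definition q :: "complex poly" where
  "q = (\<Sum>t\<in>S. Polynomial.smult (complex_of_real (p t)) (monic_roots (S - {t})))"

lemma card_S: "card S > 0"
  using finite_S S_ne by (simp add: card_gt_0_iff)

lemma degree_q_le: "degree q \<le> card S - 1"
  unfolding q_def
  by (rule degree_sum_le[OF finite_S])
     (metis card_Diff_singleton degree_monic_roots degree_smult_le)

lemma coeff_q: "poly.coeff q (card S - 1) = 1"
proof -
  have "poly.coeff q (card S - 1) = (\<Sum>t\<in>S. complex_of_real (p t) * poly.coeff (monic_roots (S - {t})) (card (S - {t})))"
    unfolding q_def coeff_sum by (intro sum.cong refl) simp
  also have "\<dots> = (\<Sum>t\<in>S. complex_of_real (p t))"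
    by (intro sum.cong refl) (subst coeff_monic_roots, simp_all add: finite_S)
  finally show ?thesis by (simp add: p_sum of_real_sum[symmetric] del: of_real_sum)
qed

lemma degree_q: "degree q = card S - 1"
  using degree_q_le le_degree[of q "card S - 1"] coeff_q by simp

lemma q_nonzero: "q \<noteq> 0"
  using coeff_q by auto

lemma poly_q:
  assumes "z \<notin> complex_of_real ` S"
  shows "poly q z = poly (monic_roots S) z * G z"
  unfolding q_def poly_sum G_def sum_distrib_left
proof (rule sum.cong[OF refl])
  fix t assume t: "t \<in> S"
  then have "z - complex_of_real t \<noteq> 0" using assms by auto
  then show "poly (Polynomial.smult (complex_of_real (p t)) (monic_roots (S - {t}))) z
      = poly (monic_roots S) z * (complex_of_real (p t) / (z - complex_of_real t))"
    using poly_monic_roots_remove[OF finite_S t, of z] by simp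
qed

text \<open>At an atom only the summand that omits its factor survives. Hence nothing cancels in
  \<open>G\<close>, and every root of \<open>q\<close> is a genuine zero of
  \<open>G\<close>.\<close>

lemma poly_q_atom: "t \<in> S \<Longrightarrow> poly q (complex_of_real t) \<noteq> 0"
proof -
  assume t: "t \<in> S"
  have "poly q (complex_of_real t) = (\<Sum>u\<in>S. if u = t then complex_of_real (p t) * poly (monic_roots (S - {t})) t else 0)"
    unfolding q_def poly_sum
    by (intro sum.cong refl) (use t finite_S in \<open>auto simp: poly_monic_roots_eq_0_iff\<close>)
  also have "\<dots> = complex_of_real (p t) * poly (monic_roots (S - {t})) t"
    using t finite_S by simp
  also have "\<dots> \<noteq> 0"
    using p_pos[OF t] finite_S by (auto simp: poly_monic_roots_eq_0_iff)
  finally show ?thesis .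
qed

text \<open>The sum on the right is positive off the atoms, so \<open>G z = 0\<close> forces
  \<open>z\<close> to be real.\<close>

lemma Im_G:
  "Im (G z) = - Im z * (\<Sum>t\<in>S. p t / (cmod (z - complex_of_real t))\<^sup>2)"
  unfolding G_def Im_sum sum_distrib_left
proof (rule sum.cong[OF refl])
  fix t
  show "Im (complex_of_real (p t) / (z - complex_of_real t)) = - Im z * (p t / (cmod (z - complex_of_real t))\<^sup>2)"
    by (simp add: Im_divide cmod_power2)
qed

lemma q_root_real:
  assumes "poly q z = 0"
  shows "Im z = 0" "z \<notin> complex_of_real ` S" "G z = 0"
proof -
  show 1: "z \<notin> complex_of_real ` S" using assms poly_q_atom by auto
  show 2: "G z = 0"
    using assms poly_q[OF 1] 1 by (auto simp: poly_monic_roots_eq_0_iff finite_S)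
  have "(\<Sum>t\<in>S. p t / (cmod (z - complex_of_real t))\<^sup>2) > 0"
    by (intro sum_pos finite_S S_ne divide_pos_pos p_pos) (use 1 in auto)
  then show "Im z = 0" using Im_G[of z] 2 by simp
qed

definition R :: "real set" where
  "R = {x. poly q (complex_of_real x) = 0}"

lemma R_image: "complex_of_real ` R = {z. poly q z = 0}"
proof -
  have "z \<in> complex_of_real ` R" if "poly q z = 0" for z
    using q_root_real(1)[OF that] that
    by (intro image_eqI[of _ _ "Re z"]) (simp_all add: R_def complex_is_Real_iff of_real_Re)
  then show ?thesis by (auto simp: R_def)
qed

lemma finite_R: "finite R"
proof -
  have "finite (complex_of_real ` R)" unfolding R_image by (rule poly_roots_finite[OF q_nonzero])
  then show ?thesis by (rule finite_imageD) (auto intro: inj_onI)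
qed

lemma R_disjoint: "R \<inter> S = {}"
  using poly_q_atom by (auto simp: R_def)

lemma H_pos: "x \<notin> S \<Longrightarrow> H x > 0"
  unfolding H_def by (intro sum_pos finite_S S_ne divide_pos_pos p_pos) auto

text \<open>Differentiate \<open>q = monic_roots S * G\<close>: the term containing \<open>G\<close>
  vanishes at a root, and the derivative of \<open>G\<close> there is minus
  \<open>H\<close>.\<close>

lemma pderiv_q_root:
  assumes "x \<in> R"
  shows "poly (pderiv q) (complex_of_real x) = - poly (monic_roots S) (complex_of_real x) * complex_of_real (H x)"
proof -
  let ?z = "complex_of_real x"
  have root: "poly q ?z = 0" using assms by (simp add: R_def)
  have z: "?z \<notin> complex_of_real ` S" and G0: "G ?z = 0" using q_root_real[OF root] by auto
  have "(G has_field_derivative (\<Sum>t\<in>S. - complex_of_real (p t) / (?z - complex_of_real t)\<^sup>2)) (at ?z)"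
    unfolding G_def
    by (rule DERIV_sum) (use z in \<open>auto intro!: derivative_eq_intros simp: power2_eq_square\<close>)
  also have "(\<Sum>t\<in>S. - complex_of_real (p t) / (?z - complex_of_real t)\<^sup>2) = - complex_of_real (H x)"
    by (simp add: H_def sum_negf)
  finally have "((\<lambda>z. poly (monic_roots S) z * G z) has_field_derivative
      poly (pderiv (monic_roots S)) ?z * G ?z + - complex_of_real (H x) * poly (monic_roots S) ?z) (at ?z)"
    by (intro DERIV_mult poly_DERIV)
  then have "((\<lambda>z. poly (monic_roots S) z * G z) has_field_derivative
      - complex_of_real (H x) * poly (monic_roots S) ?z) (at ?z)"
    by (simp add: G0)
  then have "(poly q has_field_derivative - complex_of_real (H x) * poly (monic_roots S) ?z) (at ?z)"
    \<comment> \<open>\<open>poly_q\<close> holds off the atoms only; the complement of this finite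
      set is an open neighbourhood of the root.\<close>
    by (rule has_field_derivative_transform_within_open[where S = "- complex_of_real ` S"])
       (use z finite_S in \<open>auto simp: poly_q intro: finite_imp_closed\<close>)
  from DERIV_unique[OF poly_DERIV this] show ?thesis by simp
qed

text \<open>Positivity of \<open>H\<close> makes all roots simple, and they are real; so the monic
  \<open>q\<close> is the product of distinct linear factors over \<open>R\<close>.\<close>

lemma q_eq: "q = monic_roots R"
proof -
  have "rsquarefree q"
    unfolding rsquarefree_roots
  proof (intro allI notI)
    fix z assume z: "poly q z = 0 \<and> poly (pderiv q) z = 0"
    then obtain x where x: "x \<in> R" "z = complex_of_real x" using R_image by blast
    then have "x \<notin> S" using R_disjoint by blast
    then show False
      using z pderiv_q_root[OF x(1)] x(2) H_pos[of x] finite_S by (auto simp: poly_monic_roots_eq_0_iff)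
  qed
  then have "q = (\<Prod>z | poly q z = 0. [:- z, 1:])"
    using complex_poly_decompose_rsquarefree[of q] coeff_q by (simp add: degree_q)
  then show ?thesis
    unfolding monic_roots_def R_image[symmetric] by (simp add: prod.reindex inj_on_def)
qed

section \<open>Partial fractions of 1 / G\<close>

lemma card_R: "card R = card S - 1"
  using degree_monic_roots[of R] degree_q q_eq by simp

text \<open>Compares two values of the derivative of \<open>q\<close>, from the factorization over
  \<open>R\<close> and from \<open>pderiv_q_root\<close>. In effect 1 / G =
  \<open>monic_roots S\<close> / q has residue -1 / H x at \<open>x\<close>.\<close>

lemma monic_roots_at_R:
  assumes "x \<in> R"
  shows "poly (monic_roots S) (complex_of_real x) = - complex_of_real (1 / H x) * poly (monic_roots (R - {x})) (complex_of_real x)"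
proof -
  have "pderiv q = [:- complex_of_real x, 1:] * pderiv (monic_roots (R - {x})) + monic_roots (R - {x}) * pderiv [:- complex_of_real x, 1:]"
    unfolding q_eq monic_roots_remove[OF finite_R assms] by (rule pderiv_mult)
  then have "poly (pderiv q) (complex_of_real x) = poly (monic_roots (R - {x})) (complex_of_real x)"
    by (simp add: pderiv_pCons)
  moreover have "H x \<noteq> 0" using H_pos[of x] R_disjoint assms by force
  moreover have "poly (monic_roots (R - {x})) (complex_of_real x)
      = - poly (monic_roots S) (complex_of_real x) * complex_of_real (H x)"
    using calculation pderiv_q_root[OF assms] by simp
  ultimately show ?thesis by simp
qed

definition atom :: real where "atom = (SOME t. t \<in> S)"

text \<open>Solves z - a - sum_x (1 / H x) / (z - x) = 0 at one atom, where 1 / G vanishes.\<close>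

definition a :: real where
  "a = atom - (\<Sum>x\<in>R. (1 / H x) / (atom - x))"

lemma atom_in: "atom \<in> S"
  unfolding atom_def using S_ne by (simp add: some_in_eq)

text \<open>Both sides are monic of degree \<open>card S\<close>, so it suffices to compare them at the \<open>card S - 1\<close>
  points of \<open>R\<close> and at one further point, which is what the choice of \<open>a\<close> is made for.\<close>

lemma monic_roots_S_eq:
  "monic_roots S = [:- complex_of_real a, 1:] * monic_roots R
     - (\<Sum>x\<in>R. Polynomial.smult (complex_of_real (1 / H x)) (monic_roots (R - {x})))"
  (is "_ = ?A - ?B")
proof (rule poly_eqI_degree_lead_coeff)
  let ?k = "card S" and ?Z = "complex_of_real ` insert atom R"
  have k: "?k = Suc (card R)" using card_R card_S by simp
  have degA: "degree ?A = ?k"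
    using coeff_monic_roots[OF finite_R] by (subst degree_mult_eq) (auto simp: degree_monic_roots k)
  have degB: "degree ?B < ?k"
  proof (rule degree_sum_less)
    fix x assume "x \<in> R"
    have "degree (Polynomial.smult (complex_of_real (1 / H x)) (monic_roots (R - {x}))) \<le> card (R - {x})"
      using degree_smult_le[of "complex_of_real (1 / H x)" "monic_roots (R - {x})"]
      by (simp only: degree_monic_roots)
    also have "\<dots> \<le> card R" by (rule card_mono[OF finite_R]) auto
    finally show "degree (Polynomial.smult (complex_of_real (1 / H x)) (monic_roots (R - {x}))) < ?k"
      by (simp add: k)
  qed (rule card_S)
  have "poly.coeff ?A ?k = 1"
    using degA lead_coeff_mult[of "[:- complex_of_real a, 1:]" "monic_roots R"] coeff_monic_roots[OF finite_R]
    by (simp add: degree_monic_roots)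
  then show "poly.coeff (monic_roots S) ?k = poly.coeff (?A - ?B) ?k"
    using coeff_monic_roots[OF finite_S] coeff_eq_0[OF degB] by (simp only: coeff_diff diff_zero)
  have "atom \<notin> R" using atom_in R_disjoint by blast
  then show "?k \<le> card ?Z"
    by (subst card_image) (auto simp: k finite_R inj_on_def)
  show "degree (monic_roots S) \<le> ?k" by (simp add: degree_monic_roots)
  show "degree (?A - ?B) \<le> ?k"
    using degA degB by (intro degree_diff_le) simp_all
  fix z assume "z \<in> ?Z"
  then consider "z = complex_of_real atom" | x where "x \<in> R" "z = complex_of_real x" by auto
  then show "poly (monic_roots S) z = poly (?A - ?B) z"
  proof cases
    \<comment> \<open>Both sides vanish at the atom: by the definition of \<open>a\<close>,
      \<open>?B\<close> equals \<open>monic_roots R\<close> times \<open>atom - a\<close>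
      there.\<close>
    case 1
    have "poly ?B z = (\<Sum>x\<in>R. poly (monic_roots R) z * complex_of_real ((1 / H x) / (atom - x)))"
      unfolding poly_sum
    proof (rule sum.cong[OF refl])
      fix x assume x: "x \<in> R"
      then have "atom - x \<noteq> 0" using \<open>atom \<notin> R\<close> by auto
      then have "complex_of_real atom - complex_of_real x \<noteq> 0" by auto
      then show "poly (Polynomial.smult (complex_of_real (1 / H x)) (monic_roots (R - {x}))) z
          = poly (monic_roots R) z * complex_of_real ((1 / H x) / (atom - x))"
        by (simp add: 1 poly_monic_roots_remove[OF finite_R x])
    qed
    also have "\<dots> = poly (monic_roots R) z * complex_of_real (atom - a)"
      by (simp add: a_def sum_distrib_left)
    finally have "poly (?A - ?B) z = 0"
      by (simp add: 1 algebra_simps)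
    then show ?thesis
      using atom_in finite_S by (simp add: 1 poly_monic_roots_eq_0_iff)
  next
    \<comment> \<open>At a point of \<open>R\<close> the product \<open>?A\<close> vanishes, and in
      \<open>?B\<close> only the summand of that point survives.\<close>
    case 2
    have "poly ?B z = (\<Sum>y\<in>R. if y = x then complex_of_real (1 / H x) * poly (monic_roots (R - {x})) z else 0)"
      unfolding poly_sum
      by (intro sum.cong refl) (use 2 finite_R in \<open>auto simp: poly_monic_roots_eq_0_iff\<close>)
    also have "\<dots> = complex_of_real (1 / H x) * poly (monic_roots (R - {x})) z"
      using 2 finite_R by simp
    moreover have "poly ?A z = 0"
      using 2 finite_R by (simp add: poly_monic_roots_eq_0_iff)
    ultimately show ?thesis
      using monic_roots_at_R[OF 2(1)] by (simp add: 2(2))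
  qed
qed

text \<open>\<open>monic_roots_S_eq\<close> divided by \<open>monic_roots S\<close>. The product
  form also records that the second factor is nonzero, so it can be cancelled when \<open>G\<close>
  is compared with the corner entry.\<close>

lemma G_continued_fraction:
  assumes "Im z > 0"
  shows "G z * (z - complex_of_real a - (\<Sum>x\<in>R. complex_of_real (1 / H x) / (z - complex_of_real x))) = 1"
    (is "_ * ?F = 1")
proof -
  have nonreal: "z \<noteq> complex_of_real x" for x using assms by auto
  then have P: "poly (monic_roots S) z \<noteq> 0" by (auto simp: poly_monic_roots_eq_0_iff finite_S)
  have "(\<Sum>x\<in>R. complex_of_real (1 / H x) * poly (monic_roots (R - {x})) z)
      = poly (monic_roots R) z * (\<Sum>x\<in>R. complex_of_real (1 / H x) / (z - complex_of_real x))"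
    unfolding sum_distrib_left
  proof (rule sum.cong[OF refl])
    fix x assume "x \<in> R"
    then show "complex_of_real (1 / H x) * poly (monic_roots (R - {x})) z
        = poly (monic_roots R) z * (complex_of_real (1 / H x) / (z - complex_of_real x))"
      using nonreal[of x] by (simp add: poly_monic_roots_remove[OF finite_R])
  qed
  then have "poly (monic_roots S) z = poly q z * ?F"
    by (subst monic_roots_S_eq) (simp add: poly_sum q_eq algebra_simps)
  also have "poly q z = poly (monic_roots S) z * G z"
    by (rule poly_q) (use nonreal in auto)
  finally show ?thesis using P by simp
qed

end

section \<open>Measures with finite support\<close>

context
  fixes \<mu> :: "real measure"
  assumes real_dist: "real_distribution \<mu>" and fin: "finite (measure_support \<mu>)"
begin

interpretation real_distribution \<mu> by (rule real_dist)

text \<open>Each point off the support has a null open neighbourhood; by Lindelof countably many of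
  these cover the complement.\<close>

lemma measure_compl_support: "measure \<mu> (- measure_support \<mu>) = 0"
proof -
  define \<F> where "\<F> = {U :: real set. open U \<and> measure \<mu> U = 0}"
  obtain \<F>' where F': "\<F>' \<subseteq> \<F>" "countable \<F>'" "\<Union>\<F>' = \<Union>\<F>"
    by (rule Lindelof[of \<F>]) (auto simp: \<F>_def)
  have sub: "- measure_support \<mu> \<subseteq> \<Union>\<F>'"
    unfolding F'(3) by (force simp: \<F>_def measure_support_def zero_less_measure_iff)
  have null: "\<Union>\<F>' \<in> null_sets \<mu>"
  proof -
    have "U \<in> null_sets \<mu>" if "U \<in> \<F>'" for U
      using that F'(1) by (auto simp: \<F>_def null_sets_def emeasure_eq_measure)
    then show ?thesis using null_sets_UN'[OF F'(2), of "\<lambda>U. U" \<mu>] by simp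
  qed
  have "- measure_support \<mu> \<in> sets \<mu>"
    using fin by (simp add: finite_imp_closed borel_open open_Compl)
  from null_sets_subset[OF null this sub] have "- measure_support \<mu> \<in> null_sets \<mu>" .
  then show ?thesis by (simp add: measure_eq_0_null_sets)
qed

lemma measure_finite_support:
  assumes "X \<in> sets borel"
  shows "measure \<mu> X = (\<Sum>t\<in>measure_support \<mu>. measure \<mu> {t} * indicator X t)"
proof -
  let ?S = "measure_support \<mu>"
  have S: "?S \<in> sets borel" "X \<inter> ?S \<in> sets borel" "X - ?S \<in> sets borel"
    using assms fin by (auto simp: finite_imp_closed intro!: borel_closed)
  have "measure \<mu> (X - ?S) \<le> measure \<mu> (- ?S)"
    by (rule finite_measure_mono) (use S in auto)
  then have 0: "measure \<mu> (X - ?S) = 0"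
    using measure_compl_support measure_nonneg[of \<mu> "X - ?S"] by linarith
  have "measure \<mu> X = measure \<mu> ((X \<inter> ?S) \<union> (X - ?S))"
    by (simp add: Int_Diff_Un)
  also have "\<dots> = measure \<mu> (X \<inter> ?S) + measure \<mu> (X - ?S)"
    by (rule finite_measure_Union) (use S in auto)
  also have "measure \<mu> (X \<inter> ?S) = (\<Sum>t\<in>X \<inter> ?S. measure \<mu> {t})"
    by (rule finite_measure_eq_sum_singleton) (use fin in auto)
  also have "\<dots> = (\<Sum>t\<in>?S. measure \<mu> {t} * indicator X t)"
    using fin by (simp add: Int_commute sum.inter_restrict indicator_def if_distrib cong: if_cong)
  finally show ?thesis using 0 by simp
qed

text \<open>Removing the other, finitely many, support points leaves an open neighbourhood of
  \<open>t\<close>; it has positive mass, all of it at \<open>t\<close>.\<close>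

lemma measure_atom_pos:
  assumes "t \<in> measure_support \<mu>" shows "measure \<mu> {t} > 0"
proof -
  let ?U = "- (measure_support \<mu> - {t})"
  have U: "open ?U" using fin by (intro open_Compl finite_imp_closed) simp
  then have "0 < measure \<mu> ?U" using assms by (auto simp: measure_support_def)
  also have "measure \<mu> ?U = (\<Sum>u\<in>measure_support \<mu>. measure \<mu> {u} * indicator ?U u)"
    by (rule measure_finite_support) (use U in simp)
  also have "\<dots> = (\<Sum>u\<in>measure_support \<mu>. if u = t then measure \<mu> {t} else 0)"
    by (intro sum.cong refl) (auto simp: indicator_def)
  also have "\<dots> = measure \<mu> {t}" using assms fin by simp
  finally show ?thesis .
qed

lemma sum_measure_atoms: "(\<Sum>t\<in>measure_support \<mu>. measure \<mu> {t}) = 1"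
  using measure_finite_support[of UNIV] prob_space by simp

end

text \<open>A \<open>point_measure\<close> lives on the subsets of \<open>T\<close>; the
  push-forward supplies the Borel sigma-algebra that \<open>real_distribution\<close>
  requires.\<close>

definition atomic_measure :: "real set \<Rightarrow> (real \<Rightarrow> real) \<Rightarrow> real measure" where
  "atomic_measure T w = distr (point_measure T (\<lambda>t. ennreal (w t))) borel (\<lambda>t. t)"

lemma measure_atomic_measure:
  assumes "finite T" "\<And>t. t \<in> T \<Longrightarrow> 0 \<le> w t" "X \<in> sets borel"
  shows "measure (atomic_measure T w) X = (\<Sum>t\<in>T. w t * indicator X t)"
proof -
  have "measure (atomic_measure T w) X = measure (point_measure T (\<lambda>t. ennreal (w t))) (X \<inter> T)"
    unfolding atomic_measure_def using assms(3)
    by (subst measure_distr) (auto simp: space_point_measure)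
  also have "\<dots> = (\<Sum>t\<in>X \<inter> T. w t)"
  proof -
    have "emeasure (point_measure T (\<lambda>t. ennreal (w t))) (X \<inter> T) = ennreal (\<Sum>t\<in>X \<inter> T. w t)"
      using assms(1) by (subst emeasure_point_measure_finite) (auto intro!: sum_ennreal assms(2))
    moreover have "0 \<le> (\<Sum>t\<in>X \<inter> T. w t)" using assms by (intro sum_nonneg) auto
    ultimately show ?thesis by (simp add: Sigma_Algebra.measure_def)
  qed
  also have "\<dots> = (\<Sum>t\<in>T. w t * indicator X t)"
    using assms(1) by (simp add: Int_commute sum.inter_restrict indicator_def if_distrib cong: if_cong)
  finally show ?thesis .
qed

lemma real_distribution_atomic_measure:
  assumes "finite T" "\<And>t. t \<in> T \<Longrightarrow> 0 \<le> w t" "(\<Sum>t\<in>T. w t) = 1"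
  shows "real_distribution (atomic_measure T w)"
proof -
  have "emeasure (point_measure T (\<lambda>t. ennreal (w t))) T = 1"
    using assms by (simp add: emeasure_point_measure_finite sum_ennreal)
  then have "prob_space (point_measure T (\<lambda>t. ennreal (w t)))"
    by (intro prob_spaceI) (simp add: space_point_measure)
  then have "prob_space (atomic_measure T w)"
    unfolding atomic_measure_def by (rule prob_space.prob_space_distr) simp
  then show ?thesis
    by (simp add: real_distribution_def real_distribution_axioms_def atomic_measure_def)
qed

lemma integral_atomic_measure:
  fixes f :: "real \<Rightarrow> complex"
  assumes "finite T" "\<And>t. t \<in> T \<Longrightarrow> 0 \<le> w t" "f \<in> borel_measurable borel"
  shows "(LINT t|atomic_measure T w. f t) = (\<Sum>t\<in>T. complex_of_real (w t) * f t)"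
proof -
  have "(LINT t|atomic_measure T w. f t) = (LINT t|point_measure T (\<lambda>t. ennreal (w t)). f t)"
    unfolding atomic_measure_def by (rule integral_distr) (use assms in auto)
  also have "\<dots> = (\<Sum>t\<in>T. w t *\<^sub>R f t)"
    by (rule lebesgue_integral_point_measure_finite) (use assms in auto)
  finally show ?thesis by (simp add: scaleR_conv_of_real)
qed

section \<open>Arrow-shaped data\<close>

definition diag_part :: "nat \<Rightarrow> (nat \<Rightarrow> real) \<Rightarrow> complex mat" where
  "diag_part n d = Matrix.mat n n (\<lambda>(i, j). if i = j then complex_of_real (d i) else 0)"

definition row_part :: "nat \<Rightarrow> (nat \<Rightarrow> real) \<Rightarrow> complex mat" where
  "row_part n v = Matrix.mat n n (\<lambda>(i, j). if i = 0 then complex_of_real (v j) else 0)"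

lemma diag_part_carrier: "diag_part n d \<in> carrier_mat n n"
  and row_part_carrier: "row_part n v \<in> carrier_mat n n"
  by (simp_all add: diag_part_def row_part_def)

lemma mat_adjoint_diag_part: "mat_adjoint (diag_part n d) = diag_part n d"
proof (rule eq_matI)
  fix i j assume "i < dim_row (diag_part n d)" "j < dim_col (diag_part n d)"
  then have ij: "i < n" "j < n" by (simp_all add: diag_part_def)
  show "mat_adjoint (diag_part n d) $$ (i, j) = diag_part n d $$ (i, j)"
    using ij by (simp add: index_mat_adjoint[OF diag_part_carrier ij]) (simp add: diag_part_def)
qed (simp_all add: diag_part_def mat_adjoint_def)

text \<open>Only row 0 is nonzero, and entry (0, j) of the square is
  \<open>v 0 * v j\<close>.\<close>

lemma row_part_square:
  assumes "v 0 = 0" shows "row_part n v * row_part n v = 0\<^sub>m n n"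
proof (rule eq_matI)
  fix i j assume "i < dim_row (0\<^sub>m n n :: complex mat)" "j < dim_col (0\<^sub>m n n :: complex mat)"
  then have ij: "i < n" "j < n" by simp_all
  show "(row_part n v * row_part n v) $$ (i, j) = 0\<^sub>m n n $$ (i, j)"
    unfolding index_mult_mat_sum[OF row_part_carrier row_part_carrier ij]
    using ij assms by (auto simp: row_part_def intro!: sum.neutral)
qed (simp_all add: row_part_def)

lemma scalar_upper_half:
  assumes "Im z > 0" shows "z \<cdot>\<^sub>m 1\<^sub>m n \<in> upper_half n"
proof -
  have "im_mat (z \<cdot>\<^sub>m 1\<^sub>m n) - complex_of_real (Im z) \<cdot>\<^sub>m 1\<^sub>m n = 0\<^sub>m n n"
  proof (rule eq_matI)
    fix i j assume "i < dim_row (0\<^sub>m n n :: complex mat)" "j < dim_col (0\<^sub>m n n :: complex mat)"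
    then have ij: "i < n" "j < n" by simp_all
    have "mat_adjoint (z \<cdot>\<^sub>m 1\<^sub>m n) $$ (i, j) = (if i = j then cnj z else 0)"
      using ij by (subst index_mat_adjoint[of _ n n]) auto
    then show "(im_mat (z \<cdot>\<^sub>m 1\<^sub>m n) - complex_of_real (Im z) \<cdot>\<^sub>m 1\<^sub>m n) $$ (i, j) = 0\<^sub>m n n $$ (i, j)"
      using ij by (auto simp: im_mat_def mat_adjoint_def complex_eq_iff)
  qed (auto simp: im_mat_def mat_adjoint_def)
  moreover have "psd_mat n (0\<^sub>m n n)"
    using psd_mat_Gram[of n "\<lambda>_. 0"] by (simp add: zero_mat_def split_def)
  ultimately show ?thesis
    unfolding upper_half_def using assms by (auto intro!: exI[of _ "Im z"])
qed

text \<open>The conjugation yields \<open>f\<close> in the corner and zero elsewhere. Rows below the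
  first therefore read (z - d_i) G_ij = \<delta>_ij; since \<open>v 0 = 0\<close>, \<open>f\<close>
  involves only these rows, and the corner equation becomes (z - d_0 - f) G_00 = 1.\<close>

lemma arrow_resolvent:
  assumes G: "G \<in> carrier_mat n n" and v0: "v 0 = 0" and n: "n > 0" and z: "Im z > 0"
    and eq: "z \<cdot>\<^sub>m 1\<^sub>m n * G = 1\<^sub>m n + (diag_part n d + conj_map (row_part n v) G) * G"
  shows "\<And>j. 0 < j \<Longrightarrow> j < n \<Longrightarrow> G $$ (j, j) = 1 / (z - complex_of_real (d j))"
    and "G $$ (0, 0) * (z - complex_of_real (d 0)
      - (\<Sum>j<n. complex_of_real ((v j)\<^sup>2) / (z - complex_of_real (d j)))) = 1"
proof -
  let ?D = "diag_part n d" and ?V = "row_part n v"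
  define f where "f = (\<Sum>c<n. \<Sum>k<n. complex_of_real (v c) * G $$ (c, k) * complex_of_real (v k))"
  note V = row_part_carrier[of n v] and D = diag_part_carrier[of n d]
  have C: "conj_map ?V G \<in> carrier_mat n n" by (rule conj_map_carrier[OF V G])
  have conj_entry: "conj_map ?V G $$ (i, j) = (if i = 0 \<and> j = 0 then f else 0)" if "i < n" "j < n" for i j
    unfolding conj_map_def index_conj[OF V G that] f_def
    using that by (auto simp: row_part_def intro!: sum.cong sum.neutral)
  have entry: "z * G $$ (i, j) = (if i = j then 1 else 0) + complex_of_real (d i) * G $$ (i, j)
      + (if i = 0 then f * G $$ (0, j) else 0)" if ij: "i < n" "j < n" for i j
  proof -
    have "z * G $$ (i, j) = (z \<cdot>\<^sub>m 1\<^sub>m n * G) $$ (i, j)"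
      using G ij by (simp add: mult_smult_assoc_mat[OF one_carrier_mat G])
    also have "\<dots> = (if i = j then 1 else 0) + ((?D + conj_map ?V G) * G) $$ (i, j)"
      unfolding eq using ij G C by (simp del: index_mult_mat(1))
    also have "((?D + conj_map ?V G) * G) $$ (i, j)
        = (\<Sum>l<n. (if l = i then complex_of_real (d i) * G $$ (i, j) else 0)
            + (if l = 0 then if i = 0 then f * G $$ (0, j) else 0 else 0))"
      unfolding index_mult_mat_sum[OF add_carrier_mat[OF C] G ij]
      by (intro sum.cong refl) (use ij C in \<open>auto simp: conj_entry diag_part_def algebra_simps\<close>)
    also have "\<dots> = complex_of_real (d i) * G $$ (i, j) + (if i = 0 then f * G $$ (0, j) else 0)"
      using ij n by (simp add: sum.distrib)
    finally show ?thesis by (simp add: add.assoc)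
  qed
  have nz: "z - complex_of_real (d i) \<noteq> 0" for i using z by (auto simp: complex_eq_iff)
  have G_off: "G $$ (i, j) = (if i = j then 1 / (z - complex_of_real (d i)) else 0)"
    if "0 < i" "i < n" "j < n" for i j
  proof -
    have "(z - complex_of_real (d i)) * G $$ (i, j) = (if i = j then 1 else 0)"
      using entry[OF that(2,3)] that(1) by (simp add: left_diff_distrib)
    then show ?thesis using nz[of i] by (auto simp: field_simps)
  qed
  then show "\<And>j. 0 < j \<Longrightarrow> j < n \<Longrightarrow> G $$ (j, j) = 1 / (z - complex_of_real (d j))" by simp
  have "f = (\<Sum>c<n. complex_of_real ((v c)\<^sup>2) / (z - complex_of_real (d c)))"
    unfolding f_def
  proof (rule sum.cong[OF refl])
    fix c assume "c \<in> {..<n}"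
    then have c: "c < n" by simp
    show "(\<Sum>k<n. complex_of_real (v c) * G $$ (c, k) * complex_of_real (v k))
        = complex_of_real ((v c)\<^sup>2) / (z - complex_of_real (d c))"
    proof (cases "c = 0")
      case False
      have "(\<Sum>k<n. complex_of_real (v c) * G $$ (c, k) * complex_of_real (v k))
          = (\<Sum>k<n. if k = c then complex_of_real ((v c)\<^sup>2) / (z - complex_of_real (d c)) else 0)"
        by (intro sum.cong refl) (use False c in \<open>auto simp: G_off power2_eq_square\<close>)
      then show ?thesis using c by simp
    qed (simp add: v0)
  qed
  moreover have "(z - complex_of_real (d 0) - f) * G $$ (0, 0) = 1"
    using entry[OF n n] by (simp add: algebra_simps)
  ultimately show "G $$ (0, 0) * (z - complex_of_real (d 0)
      - (\<Sum>j<n. complex_of_real ((v j)\<^sup>2) / (z - complex_of_real (d j)))) = 1"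
    by (simp add: mult.commute)
qed

theorem proposition4p1:
  fixes \<mu> :: "real measure"
  assumes "real_distribution \<mu>"
    and "finite (measure_support \<mu>)"
  shows "\<exists>(n::nat) (A :: complex mat cstar) \<iota> E D \<eta> s \<mu>\<^sub>s.
           n \<ge> 1 \<and> mat_prob_space A n \<iota> E \<and>
           is_semicircular n A \<iota> E D \<eta> s \<and>
           nilpotent_mat_map n \<eta> \<and>
           has_distribution n A \<iota> E s \<mu>\<^sub>s \<and>
           is_component \<mu> \<mu>\<^sub>s"
proof -
  define S where "S = measure_support \<mu>"
  define p where "p t = measure \<mu> {t}" for t
  have p_sum: "(\<Sum>t\<in>S. p t) = 1"
    unfolding S_def p_def by (rule sum_measure_atoms[OF assms])
  interpret finite_weights S p
  proof
    show "S \<noteq> {}" using p_sum by auto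
  qed (use assms measure_atom_pos[OF assms] p_sum in \<open>auto simp: S_def p_def\<close>)
  define r where "r = card R"
  define n where "n = Suc r"
  have n: "n > 0" "n \<ge> 1" by (simp_all add: n_def)
  obtain e where "bij_betw e {0..<r} R"
    using ex_bij_betw_nat_finite[OF finite_R] unfolding r_def by blast
  then have e: "bij_betw e {..<r} R" by (simp add: atLeast0LessThan)
  define d where "d i = (case i of 0 \<Rightarrow> a | Suc j \<Rightarrow> e j)" for i
  \<comment> \<open>Index 0 carries \<open>a\<close> and the entry 0 that makes the square of
    \<open>?V\<close> vanish; index j + 1 carries a zero of \<open>G\<close> and the root of its
    partial-fraction weight.\<close>
  define v where "v i = (case i of 0 \<Rightarrow> 0 | Suc j \<Rightarrow> sqrt (1 / H (e j)))" for i
  have v0: "v 0 = 0" by (simp add: v_def)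
  let ?\<iota> = "\<lambda>b. op_code (mat_op n b)" and ?E = "\<lambda>x. vacuum_exp n (op_decode x)"
  let ?D = "diag_part n d" and ?V = "row_part n v"
  let ?s = "op_code (semicircular_op n ?D ?V)"
  note D = diag_part_carrier[of n d] and V = row_part_carrier[of n v] and D' = mat_adjoint_diag_part[of n d]
  \<comment> \<open>Mass of \<mu> divided by \<open>n\<close> on the atoms and 1 / n at each zero of
    \<open>G\<close>; one function suffices because \<open>R\<close> and \<open>S\<close> are
    disjoint.\<close>
  define w where "w t = (if t \<in> S then p t else 1) / n" for t
  have w: "0 \<le> w t" for t
    by (auto simp: w_def p_def)
  \<comment> \<open>Stated for arbitrary \<open>f\<close> so that total mass, Stieltjes integral and
    mass of a Borel set split in the same way.\<close>
  have sum_w: "(\<Sum>t\<in>S \<union> R. f (w t) t) = (\<Sum>t\<in>S. f (p t / n) t) + (\<Sum>t\<in>R. f (1 / n) t)"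
    for f :: "real \<Rightarrow> real \<Rightarrow> 'a::comm_monoid_add"
  proof -
    have "(\<Sum>t\<in>S \<union> R. f (w t) t) = (\<Sum>t\<in>S. f (w t) t) + (\<Sum>t\<in>R. f (w t) t)"
      using R_disjoint by (intro sum.union_disjoint finite_S finite_R) auto
    also have "(\<Sum>t\<in>S. f (w t) t) = (\<Sum>t\<in>S. f (p t / n) t)"
      by (intro sum.cong refl) (simp add: w_def)
    also have "(\<Sum>t\<in>R. f (w t) t) = (\<Sum>t\<in>R. f (1 / n) t)"
      using R_disjoint by (intro sum.cong refl) (auto simp: w_def)
    finally show ?thesis .
  qed
  define \<mu>\<^sub>s where "\<mu>\<^sub>s = atomic_measure (S \<union> R) w"
  have fin: "finite (S \<union> R)" using finite_S finite_R by simp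
  have "(\<Sum>t\<in>S \<union> R. w t) = (\<Sum>t\<in>S. p t) / n + r / n"
    using sum_w[of "\<lambda>x t. x"] by (simp add: r_def sum_divide_distrib)
  \<comment> \<open>1 + r = n: one unit for \<mu> and one for each zero.\<close>
  also have "\<dots> = 1"
    by (simp add: p_sum n_def add_divide_distrib[symmetric])
  finally have \<mu>\<^sub>s: "real_distribution \<mu>\<^sub>s"
    unfolding \<mu>\<^sub>s_def by (intro real_distribution_atomic_measure fin w)
  have "has_distribution n op_cstar ?\<iota> ?E ?s \<mu>\<^sub>s"
    unfolding has_distribution_def
  proof (intro conjI allI impI \<mu>\<^sub>s)
    fix \<xi> :: complex assume \<xi>: "Im \<xi> > 0"
    define g where "g = op_cauchy op_cstar ?\<iota> ?E ?s (\<xi> \<cdot>\<^sub>m 1\<^sub>m n)"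
    note g = op_cauchy_semicircular[OF D V D' scalar_upper_half[OF \<xi>] n(1), folded g_def]
    note res = arrow_resolvent[OF g(1) v0 n(1) \<xi> g(2)]
    have "(\<Sum>j<n. complex_of_real ((v j)\<^sup>2) / (\<xi> - complex_of_real (d j)))
        = (\<Sum>j<r. complex_of_real (1 / H (e j)) / (\<xi> - complex_of_real (e j)))"
    proof -
      have "e j \<in> R" if "j < r" for j using e that by (auto simp: bij_betw_def)
      \<comment> \<open>\<open>H\<close> is positive at the zeros, so squaring undoes the square
        root.\<close>
      then have "(v (Suc j))\<^sup>2 = 1 / H (e j)" if "j < r" for j
        using that H_pos[of "e j"] R_disjoint by (fastforce simp: v_def)
      then show ?thesis
        unfolding n_def sum.lessThan_Suc_shift by (simp add: v0 d_def)
    qed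
    also have "\<dots> = (\<Sum>x\<in>R. complex_of_real (1 / H x) / (\<xi> - complex_of_real x))"
      by (rule sum.reindex_bij_betw[OF e])
    finally have "g $$ (0, 0) * (\<xi> - complex_of_real a
        - (\<Sum>x\<in>R. complex_of_real (1 / H x) / (\<xi> - complex_of_real x))) = 1"
      using res(2) by (simp add: d_def)
    then have g00: "g $$ (0, 0) = G \<xi>"
      using G_continued_fraction[OF \<xi>] mult_right_cancel[of "\<xi> - complex_of_real a
        - (\<Sum>x\<in>R. complex_of_real (1 / H x) / (\<xi> - complex_of_real x))" "g $$ (0, 0)" "G \<xi>"]
      by fastforce
    have "(\<Sum>i<n. g $$ (i, i)) = G \<xi> + (\<Sum>j<r. 1 / (\<xi> - complex_of_real (e j)))"
      unfolding n_def sum.lessThan_Suc_shift by (simp add: g00 res(1) n_def d_def)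
    also have "(\<Sum>j<r. 1 / (\<xi> - complex_of_real (e j))) = (\<Sum>x\<in>R. 1 / (\<xi> - complex_of_real x))"
      by (rule sum.reindex_bij_betw[OF e])
    finally have "norm_trace n g = (G \<xi> + (\<Sum>x\<in>R. 1 / (\<xi> - complex_of_real x))) / of_nat n"
      by (simp add: norm_trace_def)
    also have "\<dots> = (LINT t|\<mu>\<^sub>s. 1 / (\<xi> - complex_of_real t))"
    proof -
      have "(LINT t|\<mu>\<^sub>s. 1 / (\<xi> - complex_of_real t))
          = (\<Sum>t\<in>S \<union> R. complex_of_real (w t) * (1 / (\<xi> - complex_of_real t)))"
        unfolding \<mu>\<^sub>s_def by (intro integral_atomic_measure fin w) measurable
      also have "\<dots> = (G \<xi> + (\<Sum>x\<in>R. 1 / (\<xi> - complex_of_real x))) / of_nat n"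
        by (subst sum_w) (simp add: G_def sum_divide_distrib add_divide_distrib mult.commute)
      finally show ?thesis ..
    qed
    finally show "norm_trace n (op_cauchy op_cstar ?\<iota> ?E ?s (\<xi> \<cdot>\<^sub>m 1\<^sub>m n)) = (LINT t|\<mu>\<^sub>s. 1 / (\<xi> - complex_of_real t))"
      by (simp add: g_def)
  qed
  moreover have "is_component \<mu> \<mu>\<^sub>s"
    unfolding is_component_def
  \<comment> \<open>The n diagonal entries of G_s contribute equally to the normalized trace: \<mu>
    and the r point masses each have weight 1 / n. If \<mu> is a point mass, then r = 0 and the
    family is \<mu> alone.\<close>
  proof (rule exI[of _ n], rule exI[of _ "\<lambda>j. case j of 0 \<Rightarrow> \<mu> | Suc i \<Rightarrow> return borel (e i)"],
      rule exI[of _ "\<lambda>_. 1 / n"], intro conjI allI impI ballI)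
    fix j
    have "real_distribution (return borel x)" for x :: real
      by (simp add: real_distribution_def real_distribution_axioms_def prob_space_return)
    then show "real_distribution (case j of 0 \<Rightarrow> \<mu> | Suc i \<Rightarrow> return borel (e i))"
      using assms(1) by (cases j) simp_all
  next
    show "\<exists>j<n. (case j of 0 \<Rightarrow> \<mu> | Suc i \<Rightarrow> return borel (e i)) = \<mu>"
      using n by (intro exI[of _ 0]) simp
  next
    fix X :: "real set" assume X: "X \<in> sets borel"
    have "measure \<mu>\<^sub>s X = (\<Sum>t\<in>S \<union> R. w t * indicator X t)"
      unfolding \<mu>\<^sub>s_def by (intro measure_atomic_measure fin w X)
    also have "\<dots> = (\<Sum>t\<in>S. p t / n * indicator X t) + (\<Sum>t\<in>R. 1 / n * indicator X t)"
      by (rule sum_w)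
    also have "(\<Sum>t\<in>S. p t / n * indicator X t) = 1 / n * measure \<mu> X"
      by (simp add: measure_finite_support[OF assms X] S_def p_def sum_distrib_left)
    also have "(\<Sum>t\<in>R. 1 / n * indicator X t) = (\<Sum>j<r. 1 / n * indicator X (e j))"
      by (rule sum.reindex_bij_betw[OF e, symmetric])
    also have "1 / n * measure \<mu> X + (\<Sum>j<r. 1 / n * indicator X (e j))
        = (\<Sum>j<n. 1 / n * measure (case j of 0 \<Rightarrow> \<mu> | Suc i \<Rightarrow> return borel (e i)) X)"
      unfolding n_def sum.lessThan_Suc_shift using X by (simp add: measure_return)
    finally show "measure \<mu>\<^sub>s X = (\<Sum>j<n. 1 / n * measure (case j of 0 \<Rightarrow> \<mu> | Suc i \<Rightarrow> return borel (e i)) X)" .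
  qed (use n in simp_all)
  moreover note mat_prob_space_op_cstar[OF n(2)] is_semicircular_semicircular_op[OF D V D' n(1)]
    nilpotent_conj_map[OF V row_part_square[of v n, OF v0]]
  ultimately show ?thesis using n(2) by blast
qed

end
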